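(* Let the integral system $S[R_1,R_2]$ be regular at $b<\infty$. Then the principal Titchmarsh-Weyl coefficient $\widetilde q$ of its canonical singular continuation $S[\widetilde R_1,\widetilde R_2]$ coincides with the principal Titchmarsh-Weyl coefficient $q$ of the system $S[R_1,R_2]$: $$\widetilde q(\lambda)=q(\lambda),\qquad\lambda\in\mathbb{C}\setminus\mathbb{R}.$$
   Context: **Integral systems.** Let $0<b\le\infty$ and let $R_1,R_2:[0,b)\to\mathbb{R}$ be nondecreasing left-continuous functions with $R_1(0)=R_2(0)=0$; put $R_j(b):=\lim_{x\to b}R_j(x)\in[0,\infty]$. $dR_j$ is the Lebesgue-Stieltjes measure of $R_j$ on $[0,b)$. Convention: $\int_a^x f\,d\sigma:=\int_{[a,x)}f\,d\sigma$. The integral system $S[R_1,R_2]$ with spectral parameter $\lambda\in\mathbb{C}$ is $$u_1(x)=u_1(0)+\int_0^x u_2\,dR_1,\qquad u_2(x)=u_2(0)-\lambda\int_0^x u_1\,dR_2,\qquad x\in[0,b).$$ $c(\cdot,\lambda)=[c_1\ c_2]^T$ and $s(\cdot,\lambda)=[s_1\ s_2]^T$ are its unique solutions with $c_1(0,\lambda)=1$, $c_2(0,\lambda)=0$, $s_1(0,\lambda)=0$, $s_2(0,\lambda)=1$. The system is regular (at $b$) if $R_1(b)+R_2(b)<\infty$, and singular otherwise. The principal Titchmarsh-Weyl coefficient of $S[R_1,R_2]$ is $q(\lambda):=\lim_{x\to b}s_1(x,\lambda)/c_1(x,\lambda)$. **Standing assumptions.** $R_1$ and $R_2$ have no common points of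 discontinuity; and there is an interval $[0,b_0)\subseteq[0,b)$ such that the classes of $1$ and $R_1$ in $L^2(R_2,[0,b_0))$ (square-integrable functions modulo $dR_2$-a.e. equality) are linearly independent. **Canonical singular continuation.** For a regular system with $b<\infty$ it is the integral system $S[\widetilde R_1,\widetilde R_2]$ on $[0,\infty)$, that is, $$\widetilde u_1(x)=\widetilde u_1(0)+\int_0^x \widetilde u_2\,d\widetilde R_1,\qquad \widetilde u_2(x)=\widetilde u_2(0)-\lambda\int_0^x \widetilde u_1\,d\widetilde R_2,\qquad x\in[0,\infty),$$ where $$\widetilde R_1(x)=\begin{cases}R_1(x),&x\in[0,b],\\R_1(b),&x\in[b,\infty),\end{cases}\qquad\widetilde R_2(x)=\begin{cases}R_2(x),&x\in[0,b],\\R_2(b)+x-b,&x\in[b,\infty).\end{cases}$$ Its principal Titchmarsh-Weyl coefficient is $\widetilde q(\lambda)=\lim_{x\to\infty}\widetilde s_1(x,\lambda)/\widetilde c_1(x,\lambda)$, with $\widetilde c=[\widetilde c_1\ \widetilde c_2]^T$, $\widetilde s=[\widetilde s_1\ \widetilde s_2]^T$ its solutions satisfying the same initial conditions at $0$ as $c,s$. *)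

theory Defs
  imports "HOL-Analysis.Analysis"
begin

text \<open>
  The spectral parameter is \<open>z\<close>. The right endpoint \<open>b\<close> is an extended real, so that \<open>[0,b)\<close> may
  be the half-line. Functions on \<open>[0,b)\<close> are total functions on the reals whose values outside
  \<open>[0,b)\<close> are never used, and \<open>x \<rightarrow> b\<close> is \<^term>\<open>at_left b\<close> on the extended reals, composed with
  \<^const>\<open>real_of_ereal\<close>.
\<close>

definition half_open :: "ereal \<Rightarrow> real set" where
  "half_open b = {x. 0 \<le> x \<and> ereal x < b}"

definition integrator :: "ereal \<Rightarrow> (real \<Rightarrow> real) \<Rightarrow> bool" where
  "integrator b R \<longleftrightarrow> R 0 = 0 \<and> mono_on (half_open b) R \<and>
     (\<forall>x\<in>half_open b. 0 < x \<longrightarrow> continuous (at_left x) R)"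

text \<open>
  The Lebesgue-Stieltjes measure of a left-continuous \<open>R\<close>, on the space \<open>[0,b)\<close>. It is the analogue
  of \<^const>\<open>interval_measure\<close>, which is for right-continuous functions on the whole real line.
\<close>

definition LS_measure :: "ereal \<Rightarrow> (real \<Rightarrow> real) \<Rightarrow> real measure" where
  "LS_measure b R =
     extend_measure (half_open b) {(x, y). 0 \<le> x \<and> x \<le> y \<and> ereal y < b}
       (\<lambda>(x, y). {x..<y}) (\<lambda>(x, y). ennreal (R y - R x))"

definition end_value :: "ereal \<Rightarrow> (real \<Rightarrow> real) \<Rightarrow> ereal" where
  "end_value b R = Lim (at_left b) (\<lambda>x. ereal (R (real_of_ereal x)))"

definition regular_system :: "ereal \<Rightarrow> (real \<Rightarrow> real) \<Rightarrow> (real \<Rightarrow> real) \<Rightarrow> bool" where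
  "regular_system b R1 R2 \<longleftrightarrow> end_value b R1 + end_value b R2 < \<infinity>"

text \<open>
  Bochner integrals of non-integrable functions are \<open>0\<close> by convention, so a solution is
  required to be integrable. A solution is the pair \<open>(u\<^sub>1, u\<^sub>2)\<close>; extensionality only fixes the
  irrelevant values outside \<open>[0,b)\<close>, so that solutions of initial value problems are unique.
\<close>

definition solution ::
  "ereal \<Rightarrow> (real \<Rightarrow> real) \<Rightarrow> (real \<Rightarrow> real) \<Rightarrow> complex \<Rightarrow> (real \<Rightarrow> complex \<times> complex) \<Rightarrow> bool" where
  "solution b R1 R2 z u \<longleftrightarrow>
     u \<in> extensional (half_open b) \<and>
     (\<forall>x\<in>half_open b.
        set_integrable (LS_measure b R1) {0..<x} (\<lambda>t. snd (u t)) \<and>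
        set_integrable (LS_measure b R2) {0..<x} (\<lambda>t. fst (u t)) \<and>
        fst (u x) = fst (u 0) + (LINT t:{0..<x}|LS_measure b R1. snd (u t)) \<and>
        snd (u x) = snd (u 0) - z * (LINT t:{0..<x}|LS_measure b R2. fst (u t)))"

definition c_solution ::
  "ereal \<Rightarrow> (real \<Rightarrow> real) \<Rightarrow> (real \<Rightarrow> real) \<Rightarrow> complex \<Rightarrow> real \<Rightarrow> complex \<times> complex" where
  "c_solution b R1 R2 z = (THE u. solution b R1 R2 z u \<and> u 0 = (1, 0))"

definition s_solution ::
  "ereal \<Rightarrow> (real \<Rightarrow> real) \<Rightarrow> (real \<Rightarrow> real) \<Rightarrow> complex \<Rightarrow> real \<Rightarrow> complex \<times> complex" where
  "s_solution b R1 R2 z = (THE u. solution b R1 R2 z u \<and> u 0 = (0, 1))"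

definition TW_quotient ::
  "ereal \<Rightarrow> (real \<Rightarrow> real) \<Rightarrow> (real \<Rightarrow> real) \<Rightarrow> complex \<Rightarrow> real \<Rightarrow> complex" where
  "TW_quotient b R1 R2 z x = fst (s_solution b R1 R2 z x) / fst (c_solution b R1 R2 z x)"

definition principal_TW ::
  "ereal \<Rightarrow> (real \<Rightarrow> real) \<Rightarrow> (real \<Rightarrow> real) \<Rightarrow> complex \<Rightarrow> complex" where
  "principal_TW b R1 R2 z = Lim (at_left b) (\<lambda>x. TW_quotient b R1 R2 z (real_of_ereal x))"

text \<open>\<^const>\<open>Lim\<close> is total; the next predicate says that the limit actually exists.\<close>

definition has_principal_TW ::
  "ereal \<Rightarrow> (real \<Rightarrow> real) \<Rightarrow> (real \<Rightarrow> real) \<Rightarrow> complex \<Rightarrow> bool" where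
  "has_principal_TW b R1 R2 z \<longleftrightarrow>
     (\<exists>l. ((\<lambda>x. TW_quotient b R1 R2 z (real_of_ereal x)) \<longlongrightarrow> l) (at_left b))"

definition no_common_discontinuity :: "ereal \<Rightarrow> (real \<Rightarrow> real) \<Rightarrow> (real \<Rightarrow> real) \<Rightarrow> bool" where
  "no_common_discontinuity b R1 R2 \<longleftrightarrow>
     (\<forall>x\<in>half_open b. continuous (at x within half_open b) R1 \<or>
                      continuous (at x within half_open b) R2)"

definition square_integrable_on :: "'a measure \<Rightarrow> 'a set \<Rightarrow> ('a \<Rightarrow> complex) \<Rightarrow> bool" where
  "square_integrable_on M A f \<longleftrightarrow>
     set_borel_measurable M A f \<and> set_integrable M A (\<lambda>x. (cmod (f x))\<^sup>2)"

text \<open>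
  The classes of \<open>f\<close> and \<open>g\<close> in \<open>L\<^sup>2(M, A)\<close> are linearly independent; a linear combination of
  classes is zero iff the combination of representatives vanishes almost everywhere on \<open>A\<close>.
\<close>

definition L2_independent ::
  "'a measure \<Rightarrow> 'a set \<Rightarrow> ('a \<Rightarrow> complex) \<Rightarrow> ('a \<Rightarrow> complex) \<Rightarrow> bool" where
  "L2_independent M A f g \<longleftrightarrow>
     square_integrable_on M A f \<and> square_integrable_on M A g \<and>
     (\<forall>\<alpha> \<beta>. (AE x in M. x \<in> A \<longrightarrow> \<alpha> * f x + \<beta> * g x = 0) \<longrightarrow> \<alpha> = 0 \<and> \<beta> = 0)"

text \<open>
  The last two conjuncts are standing assumptions on the system. In the last one \<open>b0 = b\<close> is
  allowed.
\<close>

definition integral_system :: "ereal \<Rightarrow> (real \<Rightarrow> real) \<Rightarrow> (real \<Rightarrow> real) \<Rightarrow> bool" where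
  "integral_system b R1 R2 \<longleftrightarrow>
     0 < b \<and> integrator b R1 \<and> integrator b R2 \<and> no_common_discontinuity b R1 R2 \<and>
     (\<exists>b0. 0 < b0 \<and> b0 \<le> b \<and>
        L2_independent (LS_measure b R2) (half_open b0) (\<lambda>_. 1) (\<lambda>x. complex_of_real (R1 x)))"

text \<open>
  The canonical singular continuation, meant for regular systems with \<open>b < \<infinity>\<close>: its integrators
  are \<open>continuation1 b R1\<close> and \<open>continuation2 b R2\<close> on \<open>[0,\<infinity>)\<close>. Regularity makes the end values
  finite, so that \<^const>\<open>real_of_ereal\<close> does not change them.
\<close>

definition continuation1 :: "real \<Rightarrow> (real \<Rightarrow> real) \<Rightarrow> real \<Rightarrow> real" where
  "continuation1 b R x = (if x < b then R x else real_of_ereal (end_value (ereal b) R))"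

definition continuation2 :: "real \<Rightarrow> (real \<Rightarrow> real) \<Rightarrow> real \<Rightarrow> real" where
  "continuation2 b R x = (if x < b then R x else real_of_ereal (end_value (ereal b) R) + x - b)"

end

theory Submission
  imports Defs
begin

text \<open>
  The two quotients are quotients of the same functions. Extend the integrators to the whole line
  by \<open>0\<close> to the left of \<open>0\<close> and by the canonical continuation from \<open>b\<close> on, and let \<open>\<mu>\<close> and \<open>\<nu>\<close> be
  their Stieltjes measures. Both integral systems only see \<open>\<mu>\<close> and \<open>\<nu>\<close> on \<open>[0,b)\<close> and \<open>[0,\<infinity>)\<close>
  (\<open>LS_measure_eq\<close>, \<open>solution_restrict_space\<close>). So the solutions \<open>c\<close> and \<open>s\<close> of the system for
  \<open>\<mu>\<close> and \<open>\<nu>\<close> on the half-line, restricted to \<open>[0,b)\<close> or not, are the solutions of the regular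
  system and of its continuation (\<open>the_solution\<close>).

  Now compare the limits of \<open>s\<^sub>1 / c\<^sub>1\<close>. The measure \<open>\<mu>\<close> has no mass on \<open>[b,\<infinity>)\<close>, so \<open>s\<^sub>1\<close> and \<open>c\<^sub>1\<close>
  are constant there and the limit at \<open>\<infinity>\<close> is \<open>s\<^sub>1(b) / c\<^sub>1(b)\<close>. Both functions are left-continuous,
  so this is also the limit at \<open>b\<close>, provided that \<open>c\<^sub>1(b) \<noteq> 0\<close>.

  This last point is where \<open>z \<notin> \<real>\<close> enters (\<open>solution_nonzero\<close>). Since \<open>R\<^sub>1\<close> and \<open>R\<^sub>2\<close> do not
  jump at the same point, partial integration gives the Lagrange identity
  \<open>c\<^sub>1(b) cnj (c\<^sub>2(b)) = \<integral>|c\<^sub>2|\<^sup>2 d\<mu> - cnj z \<integral>|c\<^sub>1|\<^sup>2 d\<nu>\<close>. If \<open>c\<^sub>1(b) = 0\<close>, its imaginary part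
  yields \<open>c\<^sub>1 = 0\<close> \<open>\<nu>\<close>-almost everywhere on \<open>[0,b)\<close>. Then \<open>c\<^sub>2 = 0\<close> on \<open>[0,b)\<close>, and
  \<open>c\<^sub>1(b) = 1 + \<integral>c\<^sub>2 d\<mu> = 1\<close>, a contradiction.

  Existence and uniqueness of solutions hold for every \<open>z\<close>, with jumps of any size: the integrals
  run over \<open>[0,x)\<close>, so the value at \<open>x\<close> depends on the past only, and Picard iteration converges.
  The needed factorial decay and the Lagrange identity both come from one Fubini argument,
  \<open>prod_integral_split\<close>, which is partial integration with the contribution of common
  atoms kept as a separate term: that term is nonnegative in the first use and zero in the second.
\<close>

section \<open>Stieltjes measures of left-continuous functions\<close>

text \<open>
  Reflection at \<open>0\<close> exchanges left-continuous and right-continuous functions, and half-open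
  intervals of the two kinds.
\<close>
definition left_measure :: "(real \<Rightarrow> real) \<Rightarrow> real measure" where
  "left_measure F = distr (interval_measure (\<lambda>x. - F (- x))) borel uminus"

lemma sets_left_measure [simp, measurable_cong]: "sets (left_measure F) = sets borel"
  by (simp add: left_measure_def)

lemma space_left_measure [simp]: "space (left_measure F) = UNIV"
  by (simp add: left_measure_def)

lemma emeasure_left_measure:
  assumes mono: "mono F" and cont: "\<And>x. continuous (at_left x) F" and "x \<le> y"
  shows "emeasure (left_measure F) {x..<y} = ennreal (F y - F x)"
proof -
  have 1: "continuous (at_right a) (\<lambda>x. - F (- x))" for a
  proof -
    have "(F \<longlongrightarrow> F (- a)) (at_left (- a))"
      using cont[of "- a"] by (simp add: continuous_within)
    then have "((\<lambda>x. F (- x)) \<longlongrightarrow> F (- a)) (at_right a)"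
      by (simp add: at_left_minus filterlim_filtermap)
    then show ?thesis
      by (simp add: continuous_within tendsto_minus)
  qed
  have "emeasure (left_measure F) {x..<y} = emeasure (interval_measure (\<lambda>x. - F (- x))) {- y<..- x}"
    unfolding left_measure_def
    by (subst emeasure_distr) (auto intro!: arg_cong2[where f = emeasure])
  also have "\<dots> = ennreal (F y - F x)"
    using \<open>x \<le> y\<close> monoD[OF mono] 1 by (subst emeasure_interval_measure_Ioc) auto
  finally show ?thesis .
qed

lemma sigma_finite_left_measure:
  assumes mono: "mono F" and cont: "\<And>x. continuous (at_left x) F"
  shows "sigma_finite_measure (left_measure F)"
proof
  have "x \<in> (\<Union>n. {- real n..<real n})" for x :: real
  proof -
    obtain n where "\<bar>x\<bar> < real n" using reals_Archimedean2 by blast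
    then show ?thesis by (auto simp: abs_less_iff intro!: exI[of _ n])
  qed
  then have *: "(\<Union>n. {- real n..<real n}) = UNIV"
    by blast
  show "\<exists>A. countable A \<and> A \<subseteq> sets (left_measure F) \<and> \<Union> A = space (left_measure F) \<and>
      (\<forall>a\<in>A. emeasure (left_measure F) a \<noteq> \<infinity>)"
    by (intro exI[of _ "range (\<lambda>n. {- real n..<real n})"])
       (auto simp: * emeasure_left_measure[OF assms])
qed

lemma ereal_less_mono: "x \<le> y \<Longrightarrow> ereal y < B \<Longrightarrow> ereal x < B"
  using le_less_trans[of "ereal x" "ereal y" B] by simp

lemma half_open_borel [measurable, simp]: "half_open B \<in> sets borel"
proof -
  have "half_open B = {0..} \<inter> ereal -` {..<B}"
    by (auto simp: half_open_def)
  then show ?thesis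
    by auto
qed

text \<open>
  The generator only has intervals whose right endpoint lies strictly below \<open>B\<close>. The trace of
  \<open>[a,b)\<close> may reach up to \<open>B\<close>; it is the union of its truncations at the rationals below \<open>B\<close>.
\<close>
lemma sets_restrict_half_open:
  "sets (restrict_space borel (half_open B)) =
   sigma_sets (half_open B) ((\<lambda>(x, y). {x..<y}) ` {(x, y). 0 \<le> x \<and> x \<le> y \<and> ereal y < B})"
  (is "_ = sigma_sets ?H ?G")
proof -
  have cut: "?H \<inter> {a..<b} \<in> sigma_sets ?H ?G" for a b
  proof (cases "ereal (max 0 a) < B")
    case True
    have "?H \<inter> {a..<b} = (\<Union>q\<in>{q::rat. ereal (real_of_rat q) < B}.
        {max 0 a..<max (max 0 a) (min b (real_of_rat q))})"
    proof (intro equalityI subsetI)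
      fix x assume x: "x \<in> ?H \<inter> {a..<b}"
      then obtain q where "ereal x < ereal (real_of_rat q)" "ereal (real_of_rat q) < B"
        using ereal_dense3[of "ereal x" B] by (auto simp: half_open_def)
      with x show "x \<in> (\<Union>q\<in>{q::rat. ereal (real_of_rat q) < B}.
          {max 0 a..<max (max 0 a) (min b (real_of_rat q))})"
        by (auto simp: half_open_def intro!: exI[of _ q])
    next
      fix x assume "x \<in> (\<Union>q\<in>{q::rat. ereal (real_of_rat q) < B}.
          {max 0 a..<max (max 0 a) (min b (real_of_rat q))})"
      then obtain q where q: "ereal (real_of_rat q) < B" "0 \<le> x" "a \<le> x" "x < b" "x < real_of_rat q"
        by (auto simp: less_max_iff_disj)
      from \<open>x < real_of_rat q\<close> have "ereal x < ereal (real_of_rat q)" by simp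
      then have "ereal x < B" using q(1) by (rule less_trans)
      with q show "x \<in> ?H \<inter> {a..<b}" by (simp add: half_open_def)
    qed
    also have "\<dots> \<in> sigma_sets ?H ?G"
    proof (rule sigma_sets_UNION)
      show "countable ((\<lambda>q. {max 0 a..<max (max 0 a) (min b (real_of_rat q))}) `
          {q::rat. ereal (real_of_rat q) < B})"
        by auto
    next
      fix A assume "A \<in> (\<lambda>q. {max 0 a..<max (max 0 a) (min b (real_of_rat q))}) `
          {q::rat. ereal (real_of_rat q) < B}"
      then obtain q where q: "ereal (real_of_rat q) < B"
        and A: "A = {max 0 a..<max (max 0 a) (min b (real_of_rat q))}" by auto
      have "ereal (max (max 0 a) (min b (real_of_rat q))) < B"
        using q True by (cases "max 0 a \<le> min b (real_of_rat q)"; cases "b \<le> real_of_rat q")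
          (auto simp: max_absorb1 max_absorb2 min_absorb1 min_absorb2 dest: ereal_less_mono)
      then have "A \<in> ?G"
        unfolding A by (intro image_eqI[where x = "(max 0 a, max (max 0 a) (min b (real_of_rat q)))"]) auto
      then show "A \<in> sigma_sets ?H ?G"
        by (rule sigma_sets.Basic)
    qed
    finally show ?thesis .
  next
    case False
    have "x \<notin> ?H \<inter> {a..<b}" for x
      using False ereal_less_mono[of "max 0 a" x B] by (clarsimp simp: half_open_def)
    then have "?H \<inter> {a..<b} = {}"
      by blast
    then show ?thesis
      by (simp add: sigma_sets.Empty)
  qed
  have "sets (restrict_space borel ?H) = sigma_sets ?H ((\<inter>) ?H ` range (\<lambda>(a, b). {a..<b :: real}))"
    using half_open_borel[of B] unfolding sets_restrict_space borel_eq_atLeastLessThan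
    by (subst sigma_sets_Int[symmetric]) auto
  also have "\<dots> = sigma_sets ?H ?G"
  proof (intro equalityI sigma_sets_mono)
    show "(\<inter>) ?H ` range (\<lambda>(a, b). {a..<b :: real}) \<subseteq> sigma_sets ?H ?G"
      using cut by auto
    show "?G \<subseteq> sigma_sets ?H ((\<inter>) ?H ` range (\<lambda>(a, b). {a..<b :: real}))"
    proof
      fix A assume "A \<in> ?G"
      then obtain x y where A: "A = {x..<y}" "0 \<le> x" "x \<le> y" "ereal y < B" by auto
      then have "A = ?H \<inter> (\<lambda>(a, b). {a..<b}) (x, y)"
        by (auto simp: half_open_def intro: ereal_less_mono[OF _ \<open>ereal y < B\<close>])
      then show "A \<in> sigma_sets ?H ((\<inter>) ?H ` range (\<lambda>(a, b). {a..<b :: real}))"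
        by (metis image_eqI rangeI sigma_sets.Basic)
    qed
  qed
  finally show ?thesis .
qed

text \<open>
  \<^const>\<open>LS_measure\<close> is only useful if some measure has the prescribed values on intervals. The
  restriction of \<open>left_measure F\<close> is such a measure, and it is the only one, because
  the intervals form an intersection-stable generator on which it is finite.
\<close>
lemma LS_measure_eq:
  assumes mono: "mono F" and cont: "\<And>x. continuous (at_left x) F"
    and eq: "\<And>x. x \<in> half_open B \<Longrightarrow> R x = F x"
  shows "LS_measure B R = restrict_space (left_measure F) (half_open B)"
proof -
  define G where "G = (\<lambda>(x, y). {x..<y}) ` {(x, y). 0 \<le> x \<and> x \<le> y \<and> ereal y < B}"
  define N where "N = restrict_space (left_measure F) (half_open B)"
  have sub: "G \<subseteq> Pow (half_open B)"
    by (auto simp: G_def half_open_def intro: ereal_less_mono[OF less_imp_le])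
  have setsN: "sets N = sigma_sets (half_open B) G"
    unfolding N_def G_def sets_restrict_half_open[symmetric]
    by (rule sets_restrict_space_cong) simp
  have setsL: "sets (LS_measure B R) = sigma_sets (half_open B) G"
    using sub unfolding LS_measure_def G_def by (subst sets_extend_measure) auto
  have N: "emeasure N {x..<y} = ennreal (F y - F x)" if "0 \<le> x" "x \<le> y" "ereal y < B" for x y
  proof -
    have "{x..<y} \<subseteq> half_open B"
      using that by (auto simp: half_open_def intro: ereal_less_mono[OF less_imp_le])
    then have "emeasure N {x..<y} = emeasure (left_measure F) {x..<y}"
      unfolding N_def by (subst emeasure_restrict_space) auto
    then show ?thesis
      using emeasure_left_measure[OF mono cont \<open>x \<le> y\<close>] by simp
  qed
  have L: "emeasure (LS_measure B R) {x..<y} = ennreal (R y - R x)"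
    if xy: "0 \<le> x" "x \<le> y" "ereal y < B" for x y
  proof -
    have "emeasure (LS_measure B R) ((\<lambda>(x, y). {x..<y}) (x, y)) =
        (\<lambda>(x, y). ennreal (R y - R x)) (x, y)"
    proof (rule emeasure_extend_measure[OF LS_measure_def, where \<mu>' = "emeasure N"])
      fix i assume "i \<in> {(x, y). 0 \<le> x \<and> x \<le> y \<and> ereal y < B}"
      then obtain u v where i: "i = (u, v)" "0 \<le> u" "u \<le> v" "ereal v < B" by auto
      then have "u \<in> half_open B" "v \<in> half_open B"
        by (auto simp: half_open_def intro: ereal_less_mono[OF _ \<open>ereal v < B\<close>])
      with i eq N show "emeasure N ((\<lambda>(x, y). {x..<y}) i) = (\<lambda>(x, y). ennreal (R y - R x)) i"
        by auto
    next
      show "positive (sets (LS_measure B R)) (emeasure N)"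
        by (simp add: positive_def)
      show "countably_additive (sets (LS_measure B R)) (emeasure N)"
        using emeasure_countably_additive[of N] setsN setsL by simp
    qed (use sub xy in \<open>auto simp: G_def\<close>)
    then show ?thesis by simp
  qed
  show ?thesis
    unfolding N_def[symmetric]
  proof (rule measure_eqI_generator_eq_countable[where E = G and \<Omega> = "half_open B"
        and A = "(\<lambda>q. {0..<real_of_rat q}) ` {q. 0 \<le> q \<and> ereal (real_of_rat q) < B}"])
    show "Int_stable G"
    proof (rule Int_stableI)
      fix A C assume "A \<in> G" "C \<in> G"
      then obtain x y u v where *: "A = {x..<y}" "0 \<le> x" "x \<le> y" "ereal y < B"
        "C = {u..<v}" "0 \<le> u" "u \<le> v" "ereal v < B" unfolding G_def by auto
      let ?l = "max x u" and ?r = "max (max x u) (min y v)"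
      have "A \<inter> C = {?l..<?r}" using * by auto
      moreover have "ereal ?r < B"
        using * ereal_less_mono[of "min y v" y B] ereal_less_mono[of x y B] ereal_less_mono[of u v B]
        by (auto simp: max_def)
      ultimately show "A \<inter> C \<in> G"
        using * unfolding G_def by (intro image_eqI[where x = "(?l, ?r)"]) auto
    qed
    show "G \<subseteq> Pow (half_open B)" by fact
    show "emeasure (LS_measure B R) X = emeasure N X" if XG: "X \<in> G" for X
    proof -
      obtain x y where X: "X = {x..<y}" "0 \<le> x" "x \<le> y" "ereal y < B"
        using XG unfolding G_def by auto
      then have "x \<in> half_open B" "y \<in> half_open B"
        by (auto simp: half_open_def intro: ereal_less_mono[OF _ \<open>ereal y < B\<close>])
      then show ?thesis using X L N eq by simp
    qed
    let ?A = "(\<lambda>q. {0..<real_of_rat q}) ` {q. 0 \<le> q \<and> ereal (real_of_rat q) < B}"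
    show "?A \<subseteq> G"
      unfolding G_def by (auto intro!: image_eqI[where x = "(0, real_of_rat _)"])
    then have "\<Union> ?A \<subseteq> half_open B" using sub by blast
    moreover have "half_open B \<subseteq> \<Union> ?A"
    proof
      fix x assume x: "x \<in> half_open B"
      then obtain q where q: "ereal x < ereal (real_of_rat q)" "ereal (real_of_rat q) < B"
        using ereal_dense3[of "ereal x" B] by (auto simp: half_open_def)
      with x have "0 < real_of_rat q"
        unfolding half_open_def less_ereal.simps(1) by (blast intro: le_less_trans)
      then have "0 \<le> q" by simp
      with x q show "x \<in> \<Union> ?A" by (auto simp: half_open_def intro!: exI[of _ q])
    qed
    ultimately show "\<Union> ?A = half_open B" by blast
    show "emeasure (LS_measure B R) a \<noteq> \<infinity>" if "a \<in> ?A" for a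
      using that by (auto simp: L)
  qed (use setsL setsN in auto)
qed

section \<open>Partial integration\<close>

text \<open>
  The product is the integral of \<open>f s * g t\<close> over the plane, which splits into the open half-planes
  \<open>t < s\<close> and \<open>s < t\<close> and the diagonal. In terms of the indefinite integrals \<open>F\<close> and \<open>G\<close> it is
  the rule \<open>d(F G) = G dF + F dG + dF dG\<close>; the third term sees exactly the common atoms.
\<close>

lemma prod_integral_split:
  fixes f g :: "real \<Rightarrow> 'a::{real_normed_field, banach, second_countable_topology}"
  assumes "sigma_finite_measure \<sigma>" "sigma_finite_measure \<tau>"
    and s[measurable_cong]: "sets \<sigma> = sets borel" "sets \<tau> = sets borel"
    and f: "integrable \<sigma> f" and g: "integrable \<tau> g"
  shows "(\<integral>s. f s \<partial>\<sigma>) * (\<integral>t. g t \<partial>\<tau>) =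
     (\<integral>s. f s * (LINT t:{..<s}|\<tau>. g t) \<partial>\<sigma>) + (\<integral>t. g t * (LINT s:{..<t}|\<sigma>. f s) \<partial>\<tau>) +
     (\<integral>s. f s * (LINT t:{s}|\<tau>. g t) \<partial>\<sigma>)"
    and "integrable \<sigma> (\<lambda>s. f s * (LINT t:{..<s}|\<tau>. g t))"
    and "integrable \<tau> (\<lambda>t. g t * (LINT s:{..<t}|\<sigma>. f s))"
proof -
  interpret S: sigma_finite_measure \<sigma> by fact
  interpret T: sigma_finite_measure \<tau> by fact
  interpret P: pair_sigma_finite \<sigma> \<tau> ..
  have [measurable]: "f \<in> borel_measurable borel" "g \<in> borel_measurable borel"
    using borel_measurable_integrable[OF f] borel_measurable_integrable[OF g]
      measurable_cong_sets[OF s(1) refl, where N = borel] measurable_cong_sets[OF s(2) refl, where N = borel]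
    by simp_all
  define h where "h = (\<lambda>s t. f s * g t)"
  have int: "integrable (\<sigma> \<Otimes>\<^sub>M \<tau>) (case_prod h)"
  proof (rule P.Fubini_integrable)
    show "case_prod h \<in> borel_measurable (\<sigma> \<Otimes>\<^sub>M \<tau>)"
      unfolding h_def by measurable
    show "integrable \<sigma> (\<lambda>s. \<integral>t. norm (case_prod h (s, t)) \<partial>\<tau>)"
      using f g by (simp add: h_def norm_mult)
    show "AE s in \<sigma>. integrable \<tau> (\<lambda>t. case_prod h (s, t))"
      using g by (simp add: h_def)
  qed
  define L U D where "L = {p. snd p < (fst p :: real)}" and "U = {p. fst p < (snd p :: real)}"
    and "D = {p. fst p = (snd p :: real)}"
  have "open L" "open U" "closed D"
    unfolding L_def U_def D_def
    by (intro open_Collect_less closed_Collect_eq continuous_intros)+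
  then have "L \<in> sets (borel \<Otimes>\<^sub>M borel)" "U \<in> sets (borel \<Otimes>\<^sub>M borel)" "D \<in> sets (borel \<Otimes>\<^sub>M borel)"
    unfolding borel_prod by (auto intro: borel_open borel_closed)
  then have mL: "L \<in> sets (\<sigma> \<Otimes>\<^sub>M \<tau>)" and mU: "U \<in> sets (\<sigma> \<Otimes>\<^sub>M \<tau>)" and mD: "D \<in> sets (\<sigma> \<Otimes>\<^sub>M \<tau>)"
    unfolding sets_pair_measure_cong[OF s] by auto
  have split: "case_prod h p = indicator L p *\<^sub>R case_prod h p + indicator U p *\<^sub>R case_prod h p
      + indicator D p *\<^sub>R case_prod h p" for p
    by (cases p) (auto simp: L_def U_def D_def indicator_def)
  have intA: "integrable (\<sigma> \<Otimes>\<^sub>M \<tau>) (\<lambda>p. indicator A p *\<^sub>R case_prod h p)"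
    if "A \<in> sets (\<sigma> \<Otimes>\<^sub>M \<tau>)" for A
    using int that by (intro integrable_mult_indicator)
  then have intA': "integrable (\<sigma> \<Otimes>\<^sub>M \<tau>) (\<lambda>(s, t). indicator A (s, t) *\<^sub>R h s t)"
    if "A \<in> sets (\<sigma> \<Otimes>\<^sub>M \<tau>)" for A
    using intA[OF that] by (simp only: case_prod_unfold prod.collapse)
  note intL = intA'[OF mL] and intU = intA'[OF mU] and intD = intA'[OF mD]
  have eL: "(\<integral>t. indicator L (s, t) *\<^sub>R h s t \<partial>\<tau>) = f s * (LINT t:{..<s}|\<tau>. g t)" for s
  proof -
    have "indicator L (s, t) *\<^sub>R h s t = f s * (indicator {..<s} t *\<^sub>R g t)" for t
      by (simp add: L_def h_def indicator_def)
    then show ?thesis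
      by (simp only: set_lebesgue_integral_def integral_mult_right_zero)
  qed
  have eD: "(\<integral>t. indicator D (s, t) *\<^sub>R h s t \<partial>\<tau>) = f s * (LINT t:{s}|\<tau>. g t)" for s
  proof -
    have "indicator D (s, t) *\<^sub>R h s t = f s * (indicator {s} t *\<^sub>R g t)" for t
      by (simp add: D_def h_def indicator_def)
    then show ?thesis
      by (simp only: set_lebesgue_integral_def integral_mult_right_zero)
  qed
  have eU: "(\<integral>s. indicator U (s, t) *\<^sub>R h s t \<partial>\<sigma>) = g t * (LINT s:{..<t}|\<sigma>. f s)" for t
  proof -
    have "indicator U (s, t) *\<^sub>R h s t = g t * (indicator {..<t} s *\<^sub>R f s)" for s
      by (simp add: U_def h_def indicator_def mult.commute)
    then show ?thesis
      by (simp only: set_lebesgue_integral_def integral_mult_right_zero)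
  qed
  show "integrable \<sigma> (\<lambda>s. f s * (LINT t:{..<s}|\<tau>. g t))"
    using P.integrable_fst[OF intL] by (simp only: eL)
  show "integrable \<tau> (\<lambda>t. g t * (LINT s:{..<t}|\<sigma>. f s))"
    using P.integrable_snd[OF intU] by (simp only: eU)
  have "(\<integral>s. f s \<partial>\<sigma>) * (\<integral>t. g t \<partial>\<tau>) = (\<integral>s. (\<integral>t. h s t \<partial>\<tau>) \<partial>\<sigma>)"
    by (simp add: h_def)
  also have "\<dots> = integral\<^sup>L (\<sigma> \<Otimes>\<^sub>M \<tau>) (case_prod h)"
    by (rule P.integral_fst[OF int])
  also have "\<dots> = (\<integral>p. indicator L p *\<^sub>R case_prod h p + indicator U p *\<^sub>R case_prod h p
      + indicator D p *\<^sub>R case_prod h p \<partial>(\<sigma> \<Otimes>\<^sub>M \<tau>))"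
    by (rule Bochner_Integration.integral_cong[OF refl split])
  also have "\<dots> = (\<integral>p. indicator L p *\<^sub>R case_prod h p \<partial>(\<sigma> \<Otimes>\<^sub>M \<tau>)) +
      (\<integral>p. indicator U p *\<^sub>R case_prod h p \<partial>(\<sigma> \<Otimes>\<^sub>M \<tau>)) +
      (\<integral>p. indicator D p *\<^sub>R case_prod h p \<partial>(\<sigma> \<Otimes>\<^sub>M \<tau>))"
    using intA[OF mL] intA[OF mU] intA[OF mD] by (simp add: Bochner_Integration.integral_add)
  also have "(\<integral>p. indicator L p *\<^sub>R case_prod h p \<partial>(\<sigma> \<Otimes>\<^sub>M \<tau>)) =
      (\<integral>s. f s * (LINT t:{..<s}|\<tau>. g t) \<partial>\<sigma>)"
    using P.integral_fst[OF intL] by (simp only: eL case_prod_unfold prod.collapse)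
  also have "(\<integral>p. indicator D p *\<^sub>R case_prod h p \<partial>(\<sigma> \<Otimes>\<^sub>M \<tau>)) =
      (\<integral>s. f s * (LINT t:{s}|\<tau>. g t) \<partial>\<sigma>)"
    using P.integral_fst[OF intD] by (simp only: eD case_prod_unfold prod.collapse)
  also have "(\<integral>p. indicator U p *\<^sub>R case_prod h p \<partial>(\<sigma> \<Otimes>\<^sub>M \<tau>)) =
      (\<integral>t. g t * (LINT s:{..<t}|\<sigma>. f s) \<partial>\<tau>)"
    using P.integral_snd[OF intU] by (simp only: eU case_prod_unfold prod.collapse)
  finally show "(\<integral>s. f s \<partial>\<sigma>) * (\<integral>t. g t \<partial>\<tau>) =
     (\<integral>s. f s * (LINT t:{..<s}|\<tau>. g t) \<partial>\<sigma>) + (\<integral>t. g t * (LINT s:{..<t}|\<sigma>. f s) \<partial>\<tau>) +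
     (\<integral>s. f s * (LINT t:{s}|\<tau>. g t) \<partial>\<sigma>)" .
qed

lemma set_integral_split:
  fixes f g :: "real \<Rightarrow> 'a::{real_normed_field, banach, second_countable_topology}"
  assumes "sigma_finite_measure \<sigma>" "sigma_finite_measure \<tau>"
    and s[measurable_cong]: "sets \<sigma> = sets borel" "sets \<tau> = sets borel"
    and f: "set_integrable \<sigma> {0..<x} f" and g: "set_integrable \<tau> {0..<x} g"
  shows "(LINT s:{0..<x}|\<sigma>. f s) * (LINT t:{0..<x}|\<tau>. g t) =
     (LINT s:{0..<x}|\<sigma>. f s * (LINT t:{0..<s}|\<tau>. g t)) +
     (LINT t:{0..<x}|\<tau>. g t * (LINT s:{0..<t}|\<sigma>. f s)) +
     (LINT s:{0..<x}|\<sigma>. f s * (LINT t:{s}|\<tau>. g t))"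
    and "set_integrable \<sigma> {0..<x} (\<lambda>s. f s * (LINT t:{0..<s}|\<tau>. g t))"
    and "set_integrable \<tau> {0..<x} (\<lambda>t. g t * (LINT s:{0..<t}|\<sigma>. f s))"
proof -
  define F G where "F = (\<lambda>s. indicator {0..<x} s *\<^sub>R f s)" and "G = (\<lambda>t. indicator {0..<x} t *\<^sub>R g t)"
  have FG: "integrable \<sigma> F" "integrable \<tau> G"
    using f g by (simp_all add: F_def G_def set_integrable_def)
  have *: "F s * (LINT t:{..<s}|\<tau>. G t) = indicator {0..<x} s *\<^sub>R (f s * (LINT t:{0..<s}|\<tau>. g t))" for s
  proof (cases "s \<in> {0..<x}")
    case True
    then have "(LINT t:{..<s}|\<tau>. G t) = (LINT t:{0..<s}|\<tau>. g t)"
      unfolding set_lebesgue_integral_def G_def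
      by (intro Bochner_Integration.integral_cong) (auto simp: indicator_def)
    then show ?thesis by (simp add: F_def)
  qed (simp add: F_def)
  moreover have "G t * (LINT s:{..<t}|\<sigma>. F s) = indicator {0..<x} t *\<^sub>R (g t * (LINT s:{0..<t}|\<sigma>. f s))" for t
  proof (cases "t \<in> {0..<x}")
    case True
    then have "(LINT s:{..<t}|\<sigma>. F s) = (LINT s:{0..<t}|\<sigma>. f s)"
      unfolding set_lebesgue_integral_def F_def
      by (intro Bochner_Integration.integral_cong) (auto simp: indicator_def)
    then show ?thesis by (simp add: G_def)
  qed (simp add: G_def)
  moreover have "F s * (LINT t:{s}|\<tau>. G t) = indicator {0..<x} s *\<^sub>R (f s * (LINT t:{s}|\<tau>. g t))" for s
  proof (cases "s \<in> {0..<x}")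
    case True
    then have "(LINT t:{s}|\<tau>. G t) = (LINT t:{s}|\<tau>. g t)"
      unfolding set_lebesgue_integral_def G_def
      by (intro Bochner_Integration.integral_cong) (auto simp: indicator_def)
    then show ?thesis by (simp add: F_def)
  qed (simp add: F_def)
  moreover note prod_integral_split[OF assms(1,2) s FG]
  ultimately show "(LINT s:{0..<x}|\<sigma>. f s) * (LINT t:{0..<x}|\<tau>. g t) =
     (LINT s:{0..<x}|\<sigma>. f s * (LINT t:{0..<s}|\<tau>. g t)) +
     (LINT t:{0..<x}|\<tau>. g t * (LINT s:{0..<t}|\<sigma>. f s)) +
     (LINT s:{0..<x}|\<sigma>. f s * (LINT t:{s}|\<tau>. g t))"
    and "set_integrable \<sigma> {0..<x} (\<lambda>s. f s * (LINT t:{0..<s}|\<tau>. g t))"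
    and "set_integrable \<tau> {0..<x} (\<lambda>t. g t * (LINT s:{0..<t}|\<sigma>. f s))"
    by (simp_all only: set_lebesgue_integral_def set_integrable_def F_def G_def)
qed

section \<open>Iterated integrals and their factorial decay\<close>

text \<open>
  The system on the half-line depends on the integrators through their measures only; what
  existence and uniqueness of solutions require of these is collected here.
\<close>

locale measure_pair =
  fixes \<mu> \<nu> :: "real measure"
  assumes sigma_finite: "sigma_finite_measure \<mu>" "sigma_finite_measure \<nu>"
    and sets_borel [measurable_cong, simp]: "sets \<mu> = sets borel" "sets \<nu> = sets borel"
    and finite_init: "emeasure \<mu> {0..<x} < \<infinity>" "emeasure \<nu> {0..<x} < \<infinity>"
begin

lemma space_UNIV [simp]: "space \<mu> = UNIV" "space \<nu> = UNIV"
  using sets_eq_imp_space_eq[OF sets_borel(1)] sets_eq_imp_space_eq[OF sets_borel(2)] by simp_all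

lemma mono_set_integrable:
  fixes f :: "real \<Rightarrow> real"
  assumes "\<sigma> \<in> {\<mu>, \<nu>}" and f: "mono f" "\<And>x. 0 \<le> f x"
  shows "set_integrable \<sigma> {0..<x} f"
proof -
  have s: "sets \<sigma> = sets borel" "emeasure \<sigma> {0..<x} < \<infinity>"
    using assms(1) finite_init by auto
  have "integrable \<sigma> (\<lambda>t. indicator {0..<x} t *\<^sub>R f x)"
    using s by simp
  then show ?thesis
    unfolding set_integrable_def
  proof (rule Bochner_Integration.integrable_bound)
    have "f \<in> borel_measurable \<sigma>"
      by (subst measurable_cong_sets[OF s(1) refl]) (rule borel_measurable_mono[OF f(1)])
    then show "(\<lambda>t. indicator {0..<x} t *\<^sub>R f t) \<in> borel_measurable \<sigma>"
      using s by (intro borel_measurable_scaleR borel_measurable_indicator) auto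
    show "AE t in \<sigma>. norm (indicator {0..<x} t *\<^sub>R f t) \<le> norm (indicator {0..<x} t *\<^sub>R f x)"
      using f by (intro AE_I2) (auto simp: indicator_def monoD)
  qed
qed

definition total :: "(real \<Rightarrow> real) \<Rightarrow> real \<Rightarrow> real" where
  "total f x = (LINT t:{0..<x}|\<mu>. f t) + (LINT t:{0..<x}|\<nu>. f t)"

lemma mono_set_integral:
  fixes f :: "real \<Rightarrow> real"
  assumes "\<sigma> \<in> {\<mu>, \<nu>}" and f: "mono f" "\<And>x. 0 \<le> f x" and "x \<le> y"
  shows "(LINT t:{0..<x}|\<sigma>. f t) \<le> (LINT t:{0..<y}|\<sigma>. f t)"
  unfolding set_lebesgue_integral_def
  using mono_set_integrable[OF assms(1,2,3)] f(2) \<open>x \<le> y\<close>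
  by (intro integral_mono) (auto simp: set_integrable_def indicator_def)

lemma set_integral_nonneg_all:
  fixes f :: "real \<Rightarrow> real"
  assumes "\<And>x. 0 \<le> f x"
  shows "0 \<le> (LINT t:A|\<sigma>. f t)"
  unfolding set_lebesgue_integral_def using assms by (intro integral_nonneg_AE) auto

lemma mono_total: "mono f \<Longrightarrow> (\<And>x. 0 \<le> f x) \<Longrightarrow> mono (total f)"
  unfolding total_def by (rule monoI, intro add_mono mono_set_integral) simp_all

lemma total_nonneg: "(\<And>x. 0 \<le> f x) \<Longrightarrow> 0 \<le> total f x"
  unfolding total_def by (intro add_nonneg_nonneg set_integral_nonneg_all)

text \<open>
  Partial integration for each of the four pairs from \<open>\<mu>\<close> and \<open>\<nu>\<close>; the diagonal terms are
  nonnegative and are dropped.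
\<close>
lemma total_mult_ge:
  assumes f: "mono f" "\<And>x. 0 \<le> f x" and g: "mono g" "\<And>x. 0 \<le> g x"
  shows "total (\<lambda>t. f t * total g t) x + total (\<lambda>t. g t * total f t) x \<le> total f x * total g x"
proof -
  have *: "(LINT s:{0..<x}|\<sigma>. f s * (LINT t:{0..<s}|\<tau>. g t)) +
     (LINT t:{0..<x}|\<tau>. g t * (LINT s:{0..<t}|\<sigma>. f s))
     \<le> (LINT s:{0..<x}|\<sigma>. f s) * (LINT t:{0..<x}|\<tau>. g t)"
   and int1: "set_integrable \<sigma> {0..<x} (\<lambda>s. f s * (LINT t:{0..<s}|\<tau>. g t))"
   and int2: "set_integrable \<tau> {0..<x} (\<lambda>t. g t * (LINT s:{0..<t}|\<sigma>. f s))"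
    if "\<sigma> \<in> {\<mu>, \<nu>}" "\<tau> \<in> {\<mu>, \<nu>}" for \<sigma> \<tau>
  proof -
    have a: "sigma_finite_measure \<sigma>" "sigma_finite_measure \<tau>" "sets \<sigma> = sets borel" "sets \<tau> = sets borel"
      using that sigma_finite by auto
    note * = set_integral_split[OF a mono_set_integrable[OF that(1) f] mono_set_integrable[OF that(2) g]]
    have "0 \<le> (LINT s:{0..<x}|\<sigma>. f s * (LINT t:{s}|\<tau>. g t))"
      by (intro set_integral_nonneg_all mult_nonneg_nonneg f g)
    then show "(LINT s:{0..<x}|\<sigma>. f s * (LINT t:{0..<s}|\<tau>. g t)) +
      (LINT t:{0..<x}|\<tau>. g t * (LINT s:{0..<t}|\<sigma>. f s))
      \<le> (LINT s:{0..<x}|\<sigma>. f s) * (LINT t:{0..<x}|\<tau>. g t)"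
      using *(1)[of x] by simp
    show "set_integrable \<sigma> {0..<x} (\<lambda>s. f s * (LINT t:{0..<s}|\<tau>. g t))"
      and "set_integrable \<tau> {0..<x} (\<lambda>t. g t * (LINT s:{0..<t}|\<sigma>. f s))"
      by (rule *)+
  qed
  have sum: "(LINT s:{0..<x}|\<sigma>. f s * total g s) =
      (LINT s:{0..<x}|\<sigma>. f s * (LINT t:{0..<s}|\<mu>. g t)) + (LINT s:{0..<x}|\<sigma>. f s * (LINT t:{0..<s}|\<nu>. g t))"
     "(LINT s:{0..<x}|\<sigma>. g s * total f s) =
      (LINT s:{0..<x}|\<sigma>. g s * (LINT t:{0..<s}|\<mu>. f t)) + (LINT s:{0..<x}|\<sigma>. g s * (LINT t:{0..<s}|\<nu>. f t))"
    if "\<sigma> \<in> {\<mu>, \<nu>}" for \<sigma>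
    unfolding total_def distrib_left
    using int1[OF that, of \<mu>] int1[OF that, of \<nu>] int2[OF _ that, of \<mu>] int2[OF _ that, of \<nu>]
    by (simp_all add: set_integral_add(2))
  have m: "\<mu> \<in> {\<mu>, \<nu>}" and n: "\<nu> \<in> {\<mu>, \<nu>}" by simp_all
  show ?thesis
    unfolding total_def[of "\<lambda>t. f t * total g t"] total_def[of "\<lambda>t. g t * total f t"]
      sum[OF m] sum[OF n]
    unfolding total_def distrib_left distrib_right
    using *[OF m m] *[OF m n] *[OF n m] *[OF n n] by linarith
qed

text \<open>
  \<open>iter n x\<close> dominates all \<open>n\<close>-fold iterated integrals of \<open>1\<close> in which every integration is with
  respect to \<open>\<mu>\<close> or \<open>\<nu>\<close>. It is the majorant for Picard iteration.
\<close>
primrec iter :: "nat \<Rightarrow> real \<Rightarrow> real" where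
  "iter 0 = (\<lambda>x. 1)"
| "iter (Suc n) = total (iter n)"

lemma iter_nonneg: "0 \<le> iter n x"
  by (induction n arbitrary: x) (auto intro: total_nonneg)

lemma mono_iter: "mono (iter n)"
  by (induction n) (auto intro: mono_total iter_nonneg monoI)

lemma total_cmult: "total (\<lambda>t. c * f t) x = c * total f x"
  by (simp add: total_def distrib_left)

lemma total_le:
  assumes "mono f" "\<And>x. 0 \<le> f x" "mono g" "\<And>x. 0 \<le> g x" "\<And>x. f x \<le> g x"
  shows "total f x \<le> total g x"
  unfolding total_def using assms
  by (intro add_mono set_integral_mono mono_set_integrable) auto

text \<open>
  For continuous integrators \<open>iter n\<close> would be \<open>T^n / n!\<close> with \<open>T = total 1\<close>. Atoms turn this into an
  inequality. To avoid a chain rule for \<open>T^n\<close>, induct on the ratios: \<open>total_mult_ge\<close> for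
  \<open>iter n\<close> and \<open>1\<close> bounds \<open>T * iter (n+1)\<close> below by \<open>total (iter n * T) + iter (n+2)\<close>, and the
  induction hypothesis under the integral bounds the first summand below by \<open>(n+1) * iter (n+2)\<close>.
\<close>
lemma iter_Suc_le: "real (Suc n) * iter (Suc n) x \<le> total (\<lambda>_. 1) x * iter n x"
proof (induction n arbitrary: x)
  case 0
  show ?case by simp
next
  case (Suc n)
  let ?T = "total (\<lambda>_. 1)"
  have T: "mono ?T" "\<And>x. 0 \<le> ?T x"
    by (auto intro: mono_total total_nonneg monoI)
  have "real (Suc (Suc n)) * iter (Suc (Suc n)) x =
      total (\<lambda>t. real (Suc n) * iter (Suc n) t) x + total (iter (Suc n)) x"
    unfolding total_cmult by (simp add: algebra_simps)
  also have "total (\<lambda>t. real (Suc n) * iter (Suc n) t) x \<le> total (\<lambda>t. iter n t * ?T t) x"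
  proof (rule total_le)
    show "mono (\<lambda>t. real (Suc n) * iter (Suc n) t)"
      using mono_iter[of "Suc n"] by (intro monoI mult_left_mono) (auto dest: monoD)
    show "mono (\<lambda>t. iter n t * ?T t)"
      using mono_iter[of n] T by (intro monoI mult_mono) (auto dest: monoD intro: iter_nonneg)
    show "real (Suc n) * iter (Suc n) x \<le> iter n x * ?T x" for x
      using Suc.IH[of x] by (simp add: mult.commute)
  qed (auto intro!: mult_nonneg_nonneg iter_nonneg T total_nonneg simp del: of_nat_Suc)
  also have "total (\<lambda>t. iter n t * ?T t) x + total (iter (Suc n)) x
      \<le> total (iter n) x * ?T x"
    using total_mult_ge[of "iter n" "\<lambda>_. 1" x] mono_iter iter_nonneg by (simp add: monoI)
  finally show ?case
    by (simp add: mult.commute)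
qed

lemma iter_le: "iter n x \<le> total (\<lambda>_. 1) x ^ n / fact n"
proof (induction n)
  case (Suc n)
  have "iter (Suc n) x \<le> total (\<lambda>_. 1) x * iter n x / real (Suc n)"
    using iter_Suc_le[of n x] by (simp add: field_simps)
  also have "\<dots> \<le> total (\<lambda>_. 1) x * (total (\<lambda>_. 1) x ^ n / fact n) / real (Suc n)"
    using Suc by (intro divide_right_mono mult_left_mono total_nonneg) auto
  finally show ?case by (simp add: field_simps)
qed simp

lemma iter_summable: "summable (\<lambda>n. D * K ^ n * iter n x)" if "0 \<le> K"
proof (rule summable_comparison_test')
  show "summable (\<lambda>n. \<bar>D\<bar> * ((K * total (\<lambda>_. 1) x) ^ n / fact n))"
    using summable_exp[of "K * total (\<lambda>_. 1) x"] by (intro summable_mult) (simp add: field_simps)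
  fix n
  have "norm (D * K ^ n * iter n x) = \<bar>D\<bar> * (K ^ n * iter n x)"
    using iter_nonneg[of n x] that by (simp add: abs_mult)
  also have "\<dots> \<le> \<bar>D\<bar> * (K ^ n * (total (\<lambda>_. 1) x ^ n / fact n))"
    using iter_le[of n x] that by (intro mult_left_mono) auto
  finally show "norm (D * K ^ n * iter n x) \<le> \<bar>D\<bar> * ((K * total (\<lambda>_. 1) x) ^ n / fact n)"
    by (simp add: power_mult_distrib)
qed

lemma integral_le_iter:
  fixes f :: "real \<Rightarrow> complex"
  assumes "\<sigma> \<in> {\<mu>, \<nu>}" and le: "\<And>t. t \<in> {0..<x} \<Longrightarrow> norm (f t) \<le> D * iter n t" and "0 \<le> D"
  shows "(\<integral>t. norm (indicator {0..<x} t *\<^sub>R f t) \<partial>\<sigma>) \<le> D * iter (Suc n) x"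
    and "norm (LINT t:{0..<x}|\<sigma>. f t) \<le> D * iter (Suc n) x"
    and "set_borel_measurable \<sigma> {0..<x} f \<Longrightarrow> set_integrable \<sigma> {0..<x} f"
proof -
  have DI: "set_integrable \<sigma> {0..<x} (\<lambda>t. D * iter n t)"
    using mono_set_integrable[OF assms(1) mono_iter iter_nonneg, of x n]
    by (intro set_integrable_mult_right)
  have le': "norm (indicator {0..<x} t *\<^sub>R f t) \<le> indicator {0..<x} t *\<^sub>R (D * iter n t)" for t
    using le by (simp add: indicator_def)
  have "(\<integral>t. norm (indicator {0..<x} t *\<^sub>R f t) \<partial>\<sigma>) \<le> (LINT t:{0..<x}|\<sigma>. D * iter n t)"
    unfolding set_lebesgue_integral_def
    using DI[unfolded set_integrable_def]
    by (rule integral_mono'[OF _ le']) (intro scaleR_nonneg_nonneg mult_nonneg_nonneg iter_nonneg \<open>0 \<le> D\<close> indicator_pos_le)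
  also have "\<dots> \<le> total (\<lambda>t. D * iter n t) x"
  proof -
    have "0 \<le> (LINT t:{0..<x}|\<rho>. D * iter n t)" for \<rho>
      by (intro set_integral_nonneg_all mult_nonneg_nonneg iter_nonneg \<open>0 \<le> D\<close>)
    then show ?thesis
      using assms(1) unfolding total_def by fastforce
  qed
  finally show *: "(\<integral>t. norm (indicator {0..<x} t *\<^sub>R f t) \<partial>\<sigma>) \<le> D * iter (Suc n) x"
    by (simp only: total_cmult iter.simps)
  show "norm (LINT t:{0..<x}|\<sigma>. f t) \<le> D * iter (Suc n) x"
    unfolding set_lebesgue_integral_def by (rule order_trans[OF integral_norm_bound *])
  show "set_integrable \<sigma> {0..<x} f" if "set_borel_measurable \<sigma> {0..<x} f"
    using DI that unfolding set_integrable_def set_borel_measurable_def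
    by (rule Bochner_Integration.integrable_bound) (intro AE_I2 order_trans[OF le'], simp)
qed

section \<open>Existence and uniqueness of solutions\<close>

definition solves :: "real set \<Rightarrow> complex \<Rightarrow> (real \<Rightarrow> complex \<times> complex) \<Rightarrow> bool" where
  "solves X z u \<longleftrightarrow> (\<forall>x\<in>X.
      set_integrable \<mu> {0..<x} (\<lambda>t. snd (u t)) \<and> set_integrable \<nu> {0..<x} (\<lambda>t. fst (u t)) \<and>
      fst (u x) = fst (u 0) + (LINT t:{0..<x}|\<mu>. snd (u t)) \<and>
      snd (u x) = snd (u 0) - z * (LINT t:{0..<x}|\<nu>. fst (u t)))"

lemma solvesD:
  assumes "solves X z u" "x \<in> X"
  shows "set_integrable \<mu> {0..<x} (\<lambda>t. snd (u t))" and "set_integrable \<nu> {0..<x} (\<lambda>t. fst (u t))"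
    and "fst (u x) = fst (u 0) + (LINT t:{0..<x}|\<mu>. snd (u t))"
    and "snd (u x) = snd (u 0) - z * (LINT t:{0..<x}|\<nu>. fst (u t))"
  using assms unfolding solves_def by blast+

text \<open>
  The increments of Picard iteration: a solution with initial value \<open>w\<close> is their sum.
\<close>
primrec picard :: "complex \<Rightarrow> complex \<times> complex \<Rightarrow> nat \<Rightarrow> real \<Rightarrow> complex \<times> complex" where
  "picard z w 0 = (\<lambda>x. w)"
| "picard z w (Suc n) = (\<lambda>x. (LINT t:{0..<x}|\<mu>. snd (picard z w n t),
                             - z * (LINT t:{0..<x}|\<nu>. fst (picard z w n t))))"

lemma measurable_init_integral:
  fixes f :: "real \<Rightarrow> complex"
  assumes "\<sigma> \<in> {\<mu>, \<nu>}" and [measurable]: "f \<in> borel_measurable borel"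
  shows "(\<lambda>x. LINT t:{0..<x}|\<sigma>. f t) \<in> borel_measurable borel"
proof -
  interpret sigma_finite_measure \<sigma> using assms(1) sigma_finite by auto
  have [measurable_cong]: "sets \<sigma> = sets borel" using assms(1) by auto
  have "(\<lambda>x. \<integral>t. (if 0 \<le> t \<and> t < x then f t else 0) \<partial>\<sigma>) \<in> borel_measurable borel"
    by measurable
  moreover have "indicator {0..<x} t *\<^sub>R f t = (if 0 \<le> t \<and> t < x then f t else 0)" for x t
    by (simp add: indicator_def)
  ultimately show ?thesis
    by (simp add: set_lebesgue_integral_def)
qed

lemma picard_measurable:
  "(\<lambda>x. fst (picard z w n x)) \<in> borel_measurable borel \<and>
   (\<lambda>x. snd (picard z w n x)) \<in> borel_measurable borel"
  by (induction n) (auto intro!: measurable_init_integral borel_measurable_times)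

lemma picard_set_measurable:
  assumes "\<sigma> \<in> {\<mu>, \<nu>}"
  shows "set_borel_measurable \<sigma> {0..<x} (\<lambda>t. fst (picard z w n t))"
    and "set_borel_measurable \<sigma> {0..<x} (\<lambda>t. snd (picard z w n t))"
proof -
  have s: "sets \<sigma> = sets borel" using assms by auto
  have "(\<lambda>t. fst (picard z w n t)) \<in> borel_measurable \<sigma>" "(\<lambda>t. snd (picard z w n t)) \<in> borel_measurable \<sigma>"
    using picard_measurable[of z w n] by (simp_all add: measurable_cong_sets[OF s refl])
  then show "set_borel_measurable \<sigma> {0..<x} (\<lambda>t. fst (picard z w n t))"
    and "set_borel_measurable \<sigma> {0..<x} (\<lambda>t. snd (picard z w n t))"
    unfolding set_borel_measurable_def using s
    by (auto intro!: borel_measurable_scaleR borel_measurable_indicator)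
qed

lemma picard_le:
  "norm (fst (picard z w n x)) \<le> (norm (fst w) + norm (snd w)) * (1 + norm z) ^ n * iter n x \<and>
   norm (snd (picard z w n x)) \<le> (norm (fst w) + norm (snd w)) * (1 + norm z) ^ n * iter n x"
proof (induction n arbitrary: x)
  case (Suc n)
  let ?D = "(norm (fst w) + norm (snd w)) * (1 + norm z) ^ n"
  have D: "0 \<le> ?D" by simp
  have 1: "norm (LINT t:{0..<x}|\<mu>. snd (picard z w n t)) \<le> ?D * iter (Suc n) x"
    using Suc.IH D by (intro integral_le_iter(2)) auto
  have 2: "norm (LINT t:{0..<x}|\<nu>. fst (picard z w n t)) \<le> ?D * iter (Suc n) x"
    using Suc.IH D by (intro integral_le_iter(2)) auto
  have 3: "(norm (fst w) + norm (snd w)) * (1 + norm z) ^ Suc n * iter (Suc n) x =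
      ?D * iter (Suc n) x + norm z * (?D * iter (Suc n) x)"
    by (simp add: algebra_simps)
  have 4: "0 \<le> ?D * iter (Suc n) x"
    using D iter_nonneg by (rule mult_nonneg_nonneg)
  have "norm (fst (picard z w (Suc n) x)) \<le> ?D * iter (Suc n) x" using 1 by simp
  moreover have "norm (snd (picard z w (Suc n) x)) \<le> norm z * (?D * iter (Suc n) x)"
    using 2 by (simp add: norm_mult mult_left_mono del: iter.simps)
  moreover have "0 \<le> norm z * (?D * iter (Suc n) x)" using 4 by simp
  ultimately show ?case unfolding 3 using 4 by linarith
qed auto

text \<open>
  Termwise integration of the Picard series. The integrals of the norms are summable because
  integrating a term bounded by \<open>iter n\<close> gives one bounded by \<open>iter (n+1)\<close>.
\<close>
lemma series_set_integral:
  fixes p :: "nat \<Rightarrow> real \<Rightarrow> complex"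
  assumes \<sigma>: "\<sigma> \<in> {\<mu>, \<nu>}" and "0 \<le> D" "0 \<le> K"
    and m: "\<And>n. set_borel_measurable \<sigma> {0..<x} (p n)"
    and le: "\<And>n t. norm (p n t) \<le> D * K ^ n * iter n t"
  shows "set_integrable \<sigma> {0..<x} (\<lambda>t. \<Sum>n. p n t)"
    and "(LINT t:{0..<x}|\<sigma>. \<Sum>n. p n t) = (\<Sum>n. LINT t:{0..<x}|\<sigma>. p n t)"
proof -
  have int: "set_integrable \<sigma> {0..<x} (p n)" for n
    by (rule integral_le_iter(3)[OF \<sigma>, where D = "D * K ^ n" and n = n]) (use m le \<open>0 \<le> D\<close> \<open>0 \<le> K\<close> in auto)
  have sum: "summable (\<lambda>n. norm (p n t))" for t
    by (rule summable_comparison_test'[OF iter_summable[OF \<open>0 \<le> K\<close>, of D t]]) (simp add: le)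
  have "summable (\<lambda>n. D * K ^ n * iter (Suc n) x)"
  proof (rule summable_comparison_test')
    show "summable (\<lambda>n. D * K ^ n * iter n x * total (\<lambda>_. 1) x)"
      by (intro summable_mult2 iter_summable \<open>0 \<le> K\<close>)
    fix n
    have "iter (Suc n) x \<le> real (Suc n) * iter (Suc n) x"
      using iter_nonneg[of "Suc n" x] mult_right_mono[of 1 "real (Suc n)"] by simp
    also have "\<dots> \<le> total (\<lambda>_. 1) x * iter n x" by (rule iter_Suc_le)
    finally show "norm (D * K ^ n * iter (Suc n) x) \<le> D * K ^ n * iter n x * total (\<lambda>_. 1) x"
      using \<open>0 \<le> D\<close> \<open>0 \<le> K\<close> iter_nonneg[of "Suc n" x]
      by (simp add: abs_mult mult.assoc mult_left_mono mult.commute[of "iter n x"] del: iter.simps)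
  qed
  then have sumint: "summable (\<lambda>n. \<integral>t. norm (indicator {0..<x} t *\<^sub>R p n t) \<partial>\<sigma>)"
  proof (rule summable_comparison_test')
    fix n
    have "(\<integral>t. norm (indicator {0..<x} t *\<^sub>R p n t) \<partial>\<sigma>) \<le> D * K ^ n * iter (Suc n) x"
      using le \<open>0 \<le> D\<close> \<open>0 \<le> K\<close> by (intro integral_le_iter(1)[OF \<sigma>]) auto
    then show "norm (\<integral>t. norm (indicator {0..<x} t *\<^sub>R p n t) \<partial>\<sigma>) \<le> D * K ^ n * iter (Suc n) x"
      by (subst real_norm_def, subst abs_of_nonneg) (intro integral_nonneg_AE AE_I2 norm_ge_zero, simp only:)
  qed
  have ind: "indicator {0..<x} t *\<^sub>R (\<Sum>n. p n t) = (\<Sum>n. indicator {0..<x} t *\<^sub>R p n t)" for t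
    by (simp add: indicator_def)
  have AEs: "AE t in \<sigma>. summable (\<lambda>n. norm (indicator {0..<x} t *\<^sub>R p n t))"
    using sum by (intro AE_I2) (auto simp: indicator_def)
  show "set_integrable \<sigma> {0..<x} (\<lambda>t. \<Sum>n. p n t)"
    unfolding set_integrable_def ind
    using int sumint AEs by (intro integrable_suminf) (auto simp: set_integrable_def)
  show "(LINT t:{0..<x}|\<sigma>. \<Sum>n. p n t) = (\<Sum>n. LINT t:{0..<x}|\<sigma>. p n t)"
    unfolding set_lebesgue_integral_def ind
    using int sumint AEs by (intro integral_suminf) (auto simp: set_integrable_def)
qed

lemma exists_solution: "\<exists>u. solves UNIV z u \<and> u 0 = w"
proof -
  define u where "u = (\<lambda>x. (\<Sum>n. fst (picard z w n x), \<Sum>n. snd (picard z w n x)))"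
  let ?D = "norm (fst w) + norm (snd w)" and ?K = "1 + norm z"
  have DK: "0 \<le> ?D" "0 \<le> ?K" by auto
  note S = series_set_integral[OF _ DK]
  have S1: "set_integrable \<mu> {0..<x} (\<lambda>t. snd (u t))"
    "(LINT t:{0..<x}|\<mu>. snd (u t)) = (\<Sum>n. fst (picard z w (Suc n) x))" for x
    unfolding u_def fst_conv snd_conv picard.simps
    by (rule S; use picard_le picard_set_measurable in simp)+
  have S2: "set_integrable \<nu> {0..<x} (\<lambda>t. fst (u t))"
    "(LINT t:{0..<x}|\<nu>. fst (u t)) = (\<Sum>n. LINT t:{0..<x}|\<nu>. fst (picard z w n t))" for x
    unfolding u_def fst_conv snd_conv
    by (rule S; use picard_le picard_set_measurable in simp)+
  have sum: "summable (\<lambda>n. fst (picard z w n x))" "summable (\<lambda>n. snd (picard z w n x))" for x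
    by (rule summable_comparison_test'[OF iter_summable[OF DK(2), of ?D x]], rule picard_le[THEN conjunct1],
        rule summable_comparison_test'[OF iter_summable[OF DK(2), of ?D x]], rule picard_le[THEN conjunct2])
  have 1: "fst (u x) = fst w + (LINT t:{0..<x}|\<mu>. snd (u t))" for x
    using suminf_split_head[OF sum(1)[of x]] unfolding S1 by (simp add: u_def)
  have sum': "summable (\<lambda>n. - z * (LINT t:{0..<x}|\<nu>. fst (picard z w n t)))" for x
    using sum(2)[of x] by (subst (asm) summable_Suc_iff[symmetric]) simp
  have series: "(\<Sum>n. - z * (LINT t:{0..<x}|\<nu>. fst (picard z w n t))) = - z * (LINT t:{0..<x}|\<nu>. fst (u t))" for x
    unfolding S2
  proof (cases "z = 0")
    case False
    with sum'[of x] have "summable (\<lambda>n. LINT t:{0..<x}|\<nu>. fst (picard z w n t))"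
      by (subst (asm) summable_cmult_iff) simp
    then show "(\<Sum>n. - z * (LINT t:{0..<x}|\<nu>. fst (picard z w n t))) =
        - z * (\<Sum>n. LINT t:{0..<x}|\<nu>. fst (picard z w n t))"
      by (rule suminf_mult)
  qed simp
  have "snd (u x) = snd w + (\<Sum>n. - z * (LINT t:{0..<x}|\<nu>. fst (picard z w n t)))" for x
    using suminf_split_head[OF sum(2)[of x]] by (simp add: u_def)
  then have 2: "snd (u x) = snd w - z * (LINT t:{0..<x}|\<nu>. fst (u t))" for x
    unfolding series by (simp only: mult_minus_left diff_conv_add_uminus)
  have 0: "u 0 = w"
  proof (rule prod_eqI)
    show "fst (u 0) = fst w" unfolding 1 by (simp add: set_lebesgue_integral_def)
    show "snd (u 0) = snd w" unfolding 2 by (simp add: set_lebesgue_integral_def)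
  qed
  show ?thesis
    unfolding solves_def
    by (intro exI[of _ u] conjI ballI 0) (simp_all only: 0 1[symmetric] 2[symmetric] S1(1) S2(1))
qed

text \<open>
  The difference of two solutions is bounded, since it is an indefinite integral of integrable
  functions. Inserting a bound by \<open>iter n\<close> into the homogeneous equation gives one by
  \<open>iter (n+1)\<close>, and these bounds tend to \<open>0\<close>.
\<close>
lemma unique_solution:
  assumes u: "solves X z u" and v: "solves X z v" and eq: "u 0 = v 0"
    and X: "\<And>x y. y \<in> X \<Longrightarrow> 0 \<le> x \<Longrightarrow> x \<le> y \<Longrightarrow> x \<in> X" and y: "y \<in> X" "0 \<le> y"
  shows "u y = v y"
proof -
  define w1 w2 where "w1 = (\<lambda>t. fst (u t) - fst (v t))" and "w2 = (\<lambda>t. snd (u t) - snd (v t))"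
  have I: "set_integrable \<mu> {0..<x} w2" "set_integrable \<nu> {0..<x} w1"
    and E: "w1 x = (LINT t:{0..<x}|\<mu>. w2 t)" "w2 x = - z * (LINT t:{0..<x}|\<nu>. w1 t)"
    if "0 \<le> x" "x \<le> y" for x
  proof -
    have "x \<in> X" using X y that by blast
    then show "set_integrable \<mu> {0..<x} w2" "set_integrable \<nu> {0..<x} w1"
      "w1 x = (LINT t:{0..<x}|\<mu>. w2 t)" "w2 x = - z * (LINT t:{0..<x}|\<nu>. w1 t)"
      using u v eq unfolding solves_def w1_def w2_def
      by (auto simp: set_integral_diff algebra_simps intro!: set_integral_diff)
  qed
  \<comment> \<open>\<open>M\<close> bounds both components up to \<open>y\<close>; this starts the induction, because \<open>iter 0 = 1\<close>.\<close>
  define M where "M = (LINT t:{0..<y}|\<mu>. norm (w2 t)) +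
      norm z * (LINT t:{0..<y}|\<nu>. norm (w1 t))"
  have bound: "norm (LINT t:{0..<x}|\<sigma>. w t) \<le> (LINT t:{0..<y}|\<sigma>. norm (w t))"
    if "0 \<le> x" "x \<le> y" "set_integrable \<sigma> {0..<y} w" for x and w :: "real \<Rightarrow> complex" and \<sigma>
  proof -
    have "norm (LINT t:{0..<x}|\<sigma>. w t) \<le> (LINT t:{0..<x}|\<sigma>. norm (w t))"
      unfolding set_lebesgue_integral_def
      by (rule order_trans[OF integral_norm_bound]) simp
    also have "\<dots> \<le> (LINT t:{0..<y}|\<sigma>. norm (w t))"
      using set_integrable_norm[OF that(3)] that unfolding set_lebesgue_integral_def set_integrable_def
      by (intro integral_mono') (auto simp: indicator_def)
    finally show ?thesis .
  qed
  have "norm (w1 x) \<le> M * (1 + norm z) ^ n * iter n x \<and> norm (w2 x) \<le> M * (1 + norm z) ^ n * iter n x"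
    if "0 \<le> x" "x \<le> y" for n x
    using that
  proof (induction n arbitrary: x)
    case 0
    have "norm (w1 x) \<le> (LINT t:{0..<y}|\<mu>. norm (w2 t))"
      unfolding E(1)[OF 0] using 0 y by (intro bound I) auto
    moreover have "norm (w2 x) \<le> norm z * (LINT t:{0..<y}|\<nu>. norm (w1 t))"
      unfolding E(2)[OF 0] norm_mult norm_minus_cancel using 0 y by (intro mult_left_mono bound I) auto
    moreover have "0 \<le> norm z * (LINT t:{0..<y}|\<nu>. norm (w1 t))"
      "0 \<le> (LINT t:{0..<y}|\<mu>. norm (w2 t))"
      by (intro mult_nonneg_nonneg set_integral_nonneg_all norm_ge_zero)+
    ultimately show ?case
      unfolding M_def by simp
  next
    case (Suc n)
    let ?D = "M * (1 + norm z) ^ n"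
    have D: "0 \<le> ?D"
      unfolding M_def
      by (intro mult_nonneg_nonneg add_nonneg_nonneg set_integral_nonneg_all zero_le_power norm_ge_zero zero_le_one)
    have 1: "norm (LINT t:{0..<x}|\<mu>. w2 t) \<le> ?D * iter (Suc n) x"
      using Suc D by (intro integral_le_iter(2)) auto
    have 2: "norm (LINT t:{0..<x}|\<nu>. w1 t) \<le> ?D * iter (Suc n) x"
      using Suc D by (intro integral_le_iter(2)) auto
    have 3: "M * (1 + norm z) ^ Suc n * iter (Suc n) x =
        ?D * iter (Suc n) x + norm z * (?D * iter (Suc n) x)"
      by (simp add: algebra_simps)
    have 4: "0 \<le> ?D * iter (Suc n) x"
      using D iter_nonneg by (rule mult_nonneg_nonneg)
    have "norm (w1 x) \<le> ?D * iter (Suc n) x" using 1 E Suc.prems by simp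
    moreover have "norm (w2 x) \<le> norm z * (?D * iter (Suc n) x)"
      using 2 Suc.prems by (simp add: E norm_mult mult_left_mono del: iter.simps)
    moreover have "0 \<le> norm z * (?D * iter (Suc n) x)" using 4 by simp
    ultimately show ?case unfolding 3 using 4 by linarith
  qed
  from this[of y] have le: "norm (w1 y) \<le> M * (1 + norm z) ^ n * iter n y"
     "norm (w2 y) \<le> M * (1 + norm z) ^ n * iter n y" for n
    using y by auto
  have lim: "(\<lambda>n. M * (1 + norm z) ^ n * iter n y) \<longlonglongrightarrow> 0"
    by (intro summable_LIMSEQ_zero iter_summable) auto
  have "norm (w1 y) \<le> 0" "norm (w2 y) \<le> 0"
    by (rule LIMSEQ_le_const[OF lim]; use le in blast)+
  then show ?thesis
    by (simp add: w1_def w2_def prod_eq_iff)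
qed

section \<open>The Lagrange identity\<close>

text \<open>
  The inner integral vanishes unless \<open>s\<close> is an atom of \<open>\<nu>\<close>. There are only countably many
  such \<open>s\<close> in \<open>[0,x)\<close>, and each of them is a null set for \<open>\<mu>\<close>.
\<close>

lemma diagonal_integral_zero:
  fixes f g :: "real \<Rightarrow> complex"
  assumes no_atoms: "\<And>s. emeasure \<mu> {s} = 0 \<or> emeasure \<nu> {s} = 0"
  shows "(LINT s:{0..<x}|\<mu>. f s * (LINT t:{s}|\<nu>. g t)) = 0"
proof -
  \<comment> \<open>Restricting \<open>\<nu>\<close> to \<open>[0,x)\<close> makes it finite, so that its atoms are countable.\<close>
  define N where "N = restrict_space \<nu> {0..<x}"
  have "finite_measure N"
    unfolding N_def using finite_init(2)[of x]
    by (intro finite_measureI) (simp add: emeasure_restrict_space space_restrict_space)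
  then have "countable {s. measure N {s} \<noteq> 0}"
    by (rule finite_measure.countable_support)
  moreover have "emeasure \<nu> {s} = 0" if s: "s \<in> {0..<x}" "measure N {s} = 0" for s
  proof -
    have "emeasure \<nu> {s} \<le> emeasure \<nu> {0..<x}"
      using s by (intro emeasure_mono) auto
    then have "emeasure \<nu> {s} \<noteq> \<infinity>"
      using finite_init(2)[of x] by (auto simp: top_unique)
    moreover have "measure \<nu> {s} = 0"
      using s unfolding N_def by (subst (asm) measure_restrict_space) auto
    ultimately show ?thesis
      by (simp add: measure_eq_0_null_sets null_setsD1 emeasure_eq_ennreal_measure)
  qed
  ultimately have "countable {s \<in> {0..<x}. emeasure \<nu> {s} \<noteq> 0}"
    by (elim countable_subset[rotated]) auto
  then have "(\<Union>s\<in>{s \<in> {0..<x}. emeasure \<nu> {s} \<noteq> 0}. {s}) \<in> null_sets \<mu>"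
    using no_atoms by (intro null_sets_UN') (auto simp: null_sets_def)
  then have "AE s in \<mu>. s \<notin> {s \<in> {0..<x}. emeasure \<nu> {s} \<noteq> 0}"
    by (intro AE_not_in) simp
  then have "AE s in \<mu>. indicator {0..<x} s *\<^sub>R (f s * (LINT t:{s}|\<nu>. g t)) = 0"
  proof eventually_elim
    case (elim s)
    show ?case
    proof (cases "s \<in> {0..<x}")
      case True
      with elim have "{s} \<in> null_sets \<nu>" by (auto simp: null_sets_def)
      then have "AE t in \<nu>. t \<notin> {s}" by (rule AE_not_in)
      then have "(LINT t:{s}|\<nu>. g t) = 0"
        unfolding set_lebesgue_integral_def
        by (intro integral_eq_zero_AE) (auto elim!: eventually_mono)
      then show ?thesis by simp
    qed simp
  qed
  then show ?thesis
    unfolding set_lebesgue_integral_def by (rule integral_eq_zero_AE)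
qed

text \<open>
  Partial integration of \<open>d(u\<^sub>1 cnj u\<^sub>2) = |u\<^sub>2|\<^sup>2 d\<mu> - cnj z |u\<^sub>1|\<^sup>2 d\<nu>\<close>, applied to the increments
  \<open>F\<close> of \<open>u\<^sub>1\<close> and \<open>- cnj z * G\<close> of \<open>cnj u\<^sub>2\<close>; the initial values are then put back.
\<close>
lemma lagrange_identity:
  assumes no_atoms: "\<And>s. emeasure \<mu> {s} = 0 \<or> emeasure \<nu> {s} = 0"
    and u: "solves {0..y} z u" and "0 \<le> y"
  shows "set_integrable \<nu> {0..<y} (\<lambda>t. (norm (fst (u t)))\<^sup>2)"
    and "fst (u y) * cnj (snd (u y)) - fst (u 0) * cnj (snd (u 0)) =
      of_real (LINT t:{0..<y}|\<mu>. (norm (snd (u t)))\<^sup>2) -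
      cnj z * of_real (LINT t:{0..<y}|\<nu>. (norm (fst (u t)))\<^sup>2)"
proof -
  define f g where "f = (\<lambda>t. snd (u t))" and "g = (\<lambda>t. cnj (fst (u t)))"
  define F G where "F = (\<lambda>x. LINT t:{0..<x}|\<mu>. f t)" and "G = (\<lambda>x. LINT t:{0..<x}|\<nu>. g t)"
  have cnj: "cnj (LINT t:A|\<nu>. h t) = (LINT t:A|\<nu>. cnj (h t))" for A and h :: "real \<Rightarrow> complex"
    unfolding set_lebesgue_integral_def Bochner_Integration.integral_cnj[symmetric] by simp
  have y: "y \<in> {0..y}" using \<open>0 \<le> y\<close> by simp
  have f: "set_integrable \<mu> {0..<y} f"
    unfolding f_def by (rule solvesD(1)[OF u y])
  have "set_integrable \<nu> {0..<y} (\<lambda>t. fst (u t))"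
    by (rule solvesD(2)[OF u y])
  from integrable_cnj[OF this[unfolded set_integrable_def]] have g: "set_integrable \<nu> {0..<y} g"
    by (simp only: set_integrable_def g_def complex_cnj_scaleR)
  have u1: "fst (u x) = fst (u 0) + F x" and u2: "cnj (snd (u x)) = cnj (snd (u 0)) - cnj z * G x"
    if "0 \<le> x" "x \<le> y" for x
  proof -
    have x: "x \<in> {0..y}" using that by simp
    show "fst (u x) = fst (u 0) + F x"
      unfolding F_def f_def by (rule solvesD(3)[OF u x])
    show "cnj (snd (u x)) = cnj (snd (u 0)) - cnj z * G x"
      unfolding G_def g_def by (subst solvesD(4)[OF u x]) (simp only: complex_cnj_diff complex_cnj_mult cnj)
  qed
  note split = set_integral_split[OF sigma_finite sets_borel f g]
  have P: "of_real ((norm (snd (u t)))\<^sup>2) = cnj (snd (u 0)) * f t - cnj z * (f t * G t)"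
    and Q: "of_real ((norm (fst (u t)))\<^sup>2) = fst (u 0) * g t + g t * F t" if "t \<in> {0..<y}" for t
  proof -
    have "cnj (snd (u t)) = cnj (snd (u 0)) - cnj z * G t" "fst (u t) = fst (u 0) + F t"
      using u1[of t] u2[of t] that by simp_all
    note eq = this
    have "of_real ((norm (snd (u t)))\<^sup>2) = f t * cnj (snd (u t))"
      "of_real ((norm (fst (u t)))\<^sup>2) = fst (u t) * g t"
      by (simp_all only: complex_norm_square f_def g_def)
    then show "of_real ((norm (snd (u t)))\<^sup>2) = cnj (snd (u 0)) * f t - cnj z * (f t * G t)"
      and "of_real ((norm (fst (u t)))\<^sup>2) = fst (u 0) * g t + g t * F t"
      unfolding eq by (simp_all add: algebra_simps)
  qed
  have fG: "set_integrable \<mu> {0..<y} (\<lambda>t. f t * G t)" and gF: "set_integrable \<nu> {0..<y} (\<lambda>t. g t * F t)"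
    using split(2,3) by (simp_all only: F_def G_def)
  have FG: "F y * G y = (LINT t:{0..<y}|\<mu>. f t * G t) + (LINT t:{0..<y}|\<nu>. g t * F t)"
    using split(1) diagonal_integral_zero[OF no_atoms, of y f g] by (simp add: F_def G_def)
  have of_real: "of_real (LINT t:A|\<sigma>. h t) = (LINT t:A|\<sigma>. complex_of_real (h t))"
    for A \<sigma> and h :: "real \<Rightarrow> real"
    by (simp add: set_integral_complex_of_real)
  have "complex_of_real (LINT t:{0..<y}|\<mu>. (norm (snd (u t)))\<^sup>2) =
      (LINT t:{0..<y}|\<mu>. cnj (snd (u 0)) * f t - cnj z * (f t * G t))"
    unfolding of_real by (rule set_lebesgue_integral_cong) (simp, use P in blast)
  also have "\<dots> = cnj (snd (u 0)) * F y - cnj z * (LINT t:{0..<y}|\<mu>. f t * G t)"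
    using f fG by (simp add: set_integral_diff set_integrable_mult_right F_def)
  finally have Pint: "complex_of_real (LINT t:{0..<y}|\<mu>. (norm (snd (u t)))\<^sup>2) = \<dots>" .
  have "complex_of_real (LINT t:{0..<y}|\<nu>. (norm (fst (u t)))\<^sup>2) =
      (LINT t:{0..<y}|\<nu>. fst (u 0) * g t + g t * F t)"
    unfolding of_real by (rule set_lebesgue_integral_cong) (simp, use Q in blast)
  also have "\<dots> = fst (u 0) * G y + (LINT t:{0..<y}|\<nu>. g t * F t)"
    using g gF by (simp add: set_integral_add set_integrable_mult_right G_def)
  finally have Qint: "complex_of_real (LINT t:{0..<y}|\<nu>. (norm (fst (u t)))\<^sup>2) = \<dots>" .
  show "fst (u y) * cnj (snd (u y)) - fst (u 0) * cnj (snd (u 0)) =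
      of_real (LINT t:{0..<y}|\<mu>. (norm (snd (u t)))\<^sup>2) -
      cnj z * of_real (LINT t:{0..<y}|\<nu>. (norm (fst (u t)))\<^sup>2)"
    unfolding Pint Qint u1[OF \<open>0 \<le> y\<close> order_refl] u2[OF \<open>0 \<le> y\<close> order_refl]
  proof -
    have "(fst (u 0) + F y) * (cnj (snd (u 0)) - cnj z * G y) - fst (u 0) * cnj (snd (u 0)) =
        cnj (snd (u 0)) * F y - cnj z * (F y * G y) - cnj z * (fst (u 0) * G y)"
      by (simp add: algebra_simps)
    also have "\<dots> = cnj (snd (u 0)) * F y - cnj z * (LINT t:{0..<y}|\<mu>. f t * G t) -
        cnj z * (fst (u 0) * G y + (LINT t:{0..<y}|\<nu>. g t * F t))"
      unfolding FG by (simp add: algebra_simps)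
    finally show "(fst (u 0) + F y) * (cnj (snd (u 0)) - cnj z * G y) - fst (u 0) * cnj (snd (u 0)) = \<dots>" .
  qed
  have "set_integrable \<nu> {0..<y} (\<lambda>t. fst (u 0) * g t + g t * F t)"
    using g gF by (intro set_integral_add(1) set_integrable_mult_right) auto
  then have "set_integrable \<nu> {0..<y} (\<lambda>t. complex_of_real ((norm (fst (u t)))\<^sup>2))"
    by (subst set_integrable_cong[OF refl refl Q]) auto
  then show "set_integrable \<nu> {0..<y} (\<lambda>t. (norm (fst (u t)))\<^sup>2)"
    unfolding set_integrable_def by (drule_tac integrable_Re) simp
qed

text \<open>
  If \<open>u\<^sub>1(y) = 0\<close>, the imaginary part of the Lagrange identity is \<open>Im z * \<integral>|u\<^sub>1|\<^sup>2 d\<nu> = 0\<close>. So \<open>u\<^sub>1\<close>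
  vanishes \<open>\<nu>\<close>-almost everywhere before \<open>y\<close>, and the second equation, then the first one, show that
  the solution keeps its initial value: \<open>u\<^sub>2 = 0\<close> before \<open>y\<close> and \<open>u\<^sub>1(y) = 1\<close>.
\<close>
lemma solution_nonzero:
  assumes no_atoms: "\<And>s. emeasure \<mu> {s} = 0 \<or> emeasure \<nu> {s} = 0"
    and u: "solves {0..y} z u" and init: "u 0 = (1, 0)" and "0 \<le> y" and z: "z \<notin> \<real>"
  shows "fst (u y) \<noteq> 0"
proof
  assume zero: "fst (u y) = 0"
  note L = lagrange_identity[OF no_atoms u \<open>0 \<le> y\<close>]
  let ?q = "LINT t:{0..<y}|\<nu>. (norm (fst (u t)))\<^sup>2"
  have "Im z * ?q = 0"
    using arg_cong[OF L(2), of Im] zero init by simp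
  moreover have "Im z \<noteq> 0"
    using z by (simp add: complex_is_Real_iff)
  ultimately have "?q = 0"
    by simp
  then have "AE t in \<nu>. indicator {0..<y} t *\<^sub>R (norm (fst (u t)))\<^sup>2 = 0"
    using L(1) unfolding set_lebesgue_integral_def set_integrable_def
    by (subst (asm) integral_nonneg_eq_0_iff_AE) auto
  then have ae: "AE t in \<nu>. t \<in> {0..<y} \<longrightarrow> fst (u t) = 0"
    by eventually_elim (simp add: indicator_def split: if_splits)
  have "snd (u x) = 0" if "x \<in> {0..<y}" for x
  proof -
    have "(LINT t:{0..<x}|\<nu>. fst (u t)) = 0"
      unfolding set_lebesgue_integral_def using ae
      by (intro integral_eq_zero_AE, elim eventually_mono) (use that in \<open>auto simp: indicator_def\<close>)
    then show ?thesis
      using solvesD(4)[OF u, of x] that init by simp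
  qed
  then have "(LINT t:{0..<y}|\<mu>. snd (u t)) = 0"
    unfolding set_lebesgue_integral_def
    by (intro integral_eq_zero_AE AE_I2) (auto simp: indicator_def)
  then have "fst (u y) = 1"
    using solvesD(3)[OF u, of y] init \<open>0 \<le> y\<close> by simp
  with zero show False by simp
qed

section \<open>Behaviour of solutions at the right endpoint\<close>

lemma init_integral_left_continuous:
  fixes f :: "real \<Rightarrow> complex"
  assumes "\<sigma> \<in> {\<mu>, \<nu>}" and f: "set_integrable \<sigma> {0..<y} f" and "0 < y"
  shows "((\<lambda>x. LINT t:{0..<x}|\<sigma>. f t) \<longlongrightarrow> (LINT t:{0..<y}|\<sigma>. f t)) (at_left y)"
proof (rule tendsto_at_left_sequentially[OF \<open>0 < y\<close>])
  fix S assume S: "\<And>n. S n < y" "incseq S" "S \<longlonglongrightarrow> y"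
  have s: "sets \<sigma> = sets borel" using assms(1) by auto
  have eq: "indicator {0..<x} t *\<^sub>R f t = indicator {0..<x} t *\<^sub>R (indicator {0..<y} t *\<^sub>R f t)" if "x \<le> y" for x t
    using that by (simp add: indicator_def)
  show "(\<lambda>n. LINT t:{0..<S n}|\<sigma>. f t) \<longlonglongrightarrow> (LINT t:{0..<y}|\<sigma>. f t)"
    unfolding set_lebesgue_integral_def
  proof (rule integral_dominated_convergence[where w = "\<lambda>t. norm (indicator {0..<y} t *\<^sub>R f t)"])
    show "(\<lambda>t. indicator {0..<y} t *\<^sub>R f t) \<in> borel_measurable \<sigma>"
      using f by (auto simp: set_integrable_def)
    then show "(\<lambda>t. indicator {0..<S n} t *\<^sub>R f t) \<in> borel_measurable \<sigma>" for n
      by (subst eq[OF less_imp_le[OF S(1)]])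
        (rule borel_measurable_scaleR[OF borel_measurable_indicator], simp_all add: s)
    show "integrable \<sigma> (\<lambda>t. norm (indicator {0..<y} t *\<^sub>R f t))"
      using f unfolding set_integrable_def by (rule integrable_norm)
    show "AE t in \<sigma>. norm (indicator {0..<S n} t *\<^sub>R f t) \<le> norm (indicator {0..<y} t *\<^sub>R f t)" for n
      using S(1)[of n] by (intro AE_I2) (auto simp: indicator_def)
    show "AE t in \<sigma>. (\<lambda>n. indicator {0..<S n} t *\<^sub>R f t) \<longlonglongrightarrow> indicator {0..<y} t *\<^sub>R f t"
    proof (intro AE_I2 tendsto_eventually)
      fix t
      show "\<forall>\<^sub>F n in sequentially. indicator {0..<S n} t *\<^sub>R f t = indicator {0..<y} t *\<^sub>R f t"
      proof (cases "t < y")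
        case True
        then have "\<forall>\<^sub>F n in sequentially. t < S n"
          using S(3) by (simp add: order_tendsto_iff)
        then show ?thesis
          by eventually_elim (use True in \<open>simp add: indicator_def\<close>)
      next
        case False
        then have "\<not> t < S n" for n
          using S(1)[of n] by linarith
        with False show ?thesis
          by (simp add: indicator_def)
      qed
    qed
  qed
qed

lemma solution_left_continuous:
  assumes "solves UNIV z u" "0 < y"
  shows "((\<lambda>x. fst (u x)) \<longlongrightarrow> fst (u y)) (at_left y)"
proof -
  have eq: "fst (u x) = fst (u 0) + (LINT t:{0..<x}|\<mu>. snd (u t))" 
    and int: "set_integrable \<mu> {0..<y} (\<lambda>t. snd (u t))" for x
    using assms unfolding solves_def by blast+
  have "((\<lambda>x. fst (u 0) + (LINT t:{0..<x}|\<mu>. snd (u t))) \<longlongrightarrow>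
      fst (u 0) + (LINT t:{0..<y}|\<mu>. snd (u t))) (at_left y)"
    by (intro tendsto_intros init_integral_left_continuous) (use assms int in auto)
  then show ?thesis
    by (simp only: eq[symmetric])
qed

lemma solution_eventually_const:
  assumes u: "solves UNIV z u" and "0 \<le> y" "y \<le> x" and null: "emeasure \<mu> {y..<x} = 0"
  shows "fst (u x) = fst (u y)"
proof -
  have "{y..<x} \<in> null_sets \<mu>" using null by (simp add: null_sets_def)
  then have ae: "AE t in \<mu>. t \<notin> {y..<x}" by (rule AE_not_in)
  have eq: "fst (u x) = fst (u 0) + (LINT t:{0..<x}|\<mu>. snd (u t))"
    "fst (u y) = fst (u 0) + (LINT t:{0..<y}|\<mu>. snd (u t))"
    "set_integrable \<mu> {0..<x} (\<lambda>t. snd (u t))"  "set_integrable \<mu> {0..<y} (\<lambda>t. snd (u t))"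
    using u unfolding solves_def by blast+
  have "(LINT t:{0..<x}|\<mu>. snd (u t)) = (LINT t:{0..<y}|\<mu>. snd (u t))"
    unfolding set_lebesgue_integral_def
  proof (rule integral_cong_AE)
    show "AE t in \<mu>. indicator {0..<x} t *\<^sub>R snd (u t) = indicator {0..<y} t *\<^sub>R snd (u t)"
      using ae by eventually_elim (use assms in \<open>auto simp: indicator_def\<close>)
  qed (use eq(3,4) in \<open>auto simp: set_integrable_def\<close>)
  then show ?thesis by (simp only: eq)
qed

lemma solves_cong:
  assumes eq: "\<And>x. x \<in> X \<Longrightarrow> u x = v x" and X: "\<And>x. x \<in> X \<Longrightarrow> 0 \<le> x \<and> {0..x} \<subseteq> X"
  shows "solves X z u \<longleftrightarrow> solves X z v"
proof -
  have "u 0 = v 0" if "x \<in> X" for x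
    using X[OF that] by (intro eq) auto
  moreover have "u t = v t" if "x \<in> X" "t \<in> {0..<x}" for x t
    using X[OF that(1)] that(2) by (intro eq) auto
  then have "set_integrable \<sigma> {0..<x} (\<lambda>t. h (u t)) = set_integrable \<sigma> {0..<x} (\<lambda>t. h (v t))"
    "(LINT t:{0..<x}|\<sigma>. h (u t)) = (LINT t:{0..<x}|\<sigma>. h (v t))"
    if "x \<in> X" for x \<sigma> and h :: "complex \<times> complex \<Rightarrow> complex"
    using that unfolding set_integrable_def set_lebesgue_integral_def
    by (auto intro!: Bochner_Integration.integrable_cong Bochner_Integration.integral_cong
        simp: indicator_def)
  ultimately show ?thesis
    unfolding solves_def using eq by auto
qed

end

section \<open>Extension of the integrators\<close>

lemma at_left_ereal_neq_bot [simp]: "at_left (ereal b) \<noteq> bot" "at_left (\<infinity> :: ereal) \<noteq> bot"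
  by (simp_all add: at_left_ereal at_left_PInf filtermap_bot_iff)

text \<open>\<^const>\<open>end_value\<close> is defined by \<^const>\<open>Lim\<close>, which is meaningful because the limit, the supremum of
  a monotone function, exists.\<close>
lemma integrator_end_value:
  assumes R: "integrator (ereal b) R" and "0 < b"
  shows "((\<lambda>x. ereal (R x)) \<longlongrightarrow> end_value (ereal b) R) (at_left b)"
    and "\<And>x. 0 \<le> x \<Longrightarrow> x < b \<Longrightarrow> ereal (R x) \<le> end_value (ereal b) R"
proof -
  define S where "S = (SUP x\<in>{0..<b}. ereal (R x))"
  have mono: "R x \<le> R y" if "0 \<le> x" "x \<le> y" "y < b" for x y
    using R that by (auto simp: integrator_def half_open_def intro: mono_onD)
  have le: "ereal (R x) \<le> S" if "0 \<le> x" "x < b" for x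
    unfolding S_def using that by (intro SUP_upper) auto
  have lim: "((\<lambda>x. ereal (R x)) \<longlongrightarrow> S) (at_left b)"
  proof (rule increasing_tendsto)
    show "\<forall>\<^sub>F x in at_left b. ereal (R x) \<le> S"
      unfolding eventually_at_left[OF \<open>0 < b\<close>] using le \<open>0 < b\<close> by (intro exI[of _ 0]) auto
  next
    fix c assume "c < S"
    then obtain y where y: "0 \<le> y" "y < b" "c < ereal (R y)"
      unfolding S_def less_SUP_iff by auto
    have "c < ereal (R x)" if "y < x" "x < b" for x
      using y that mono[of y x] by (intro less_le_trans[OF y(3)]) auto
    then show "\<forall>\<^sub>F x in at_left b. c < ereal (R x)"
      unfolding eventually_at_left[OF \<open>y < b\<close>] using y by blast
  qed
  have "((\<lambda>x. ereal (R (real_of_ereal x))) \<longlongrightarrow> S) (at_left (ereal b))"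
    using lim by (simp add: at_left_ereal filterlim_filtermap)
  then have "end_value (ereal b) R = S"
    unfolding end_value_def by (intro tendsto_Lim) simp_all
  with lim le show "((\<lambda>x. ereal (R x)) \<longlongrightarrow> end_value (ereal b) R) (at_left b)"
    and "\<And>x. 0 \<le> x \<Longrightarrow> x < b \<Longrightarrow> ereal (R x) \<le> end_value (ereal b) R"
    by simp_all
qed

lemma regular_end_value:
  assumes "integrator (ereal b) R1" "integrator (ereal b) R2" "0 < b" "regular_system (ereal b) R1 R2"
  obtains r1 r2 where "end_value (ereal b) R1 = ereal r1" "end_value (ereal b) R2 = ereal r2"
proof -
  have "0 \<le> end_value (ereal b) R1" "0 \<le> end_value (ereal b) R2"
    using integrator_end_value(2)[OF assms(1,3), of 0] integrator_end_value(2)[OF assms(2,3), of 0] assms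
    by (auto simp: integrator_def zero_ereal_def)
  moreover have "end_value (ereal b) R1 + end_value (ereal b) R2 < \<infinity>"
    using assms(4) by (simp add: regular_system_def)
  ultimately show ?thesis
    using that by (cases "end_value (ereal b) R1"; cases "end_value (ereal b) R2") auto
qed

text \<open>
  With end value \<open>r\<close>, slope \<open>k = 0\<close> gives \<^const>\<open>continuation1\<close> and slope \<open>k = 1\<close> gives
  \<^const>\<open>continuation2\<close> on the half-line. The value \<open>0\<close> for negative arguments
  makes the function left-continuous at \<open>0\<close>.
\<close>
definition extend_integrator :: "real \<Rightarrow> real \<Rightarrow> real \<Rightarrow> (real \<Rightarrow> real) \<Rightarrow> real \<Rightarrow> real" where
  "extend_integrator k b r R x = (if x < 0 then 0 else if x < b then R x else r + k * (x - b))"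

lemma extend_integrator_regular:
  assumes R: "integrator (ereal b) R" and "0 < b" and r: "end_value (ereal b) R = ereal r" and "0 \<le> k"
  shows "mono (extend_integrator k b r R)" and "continuous (at_left x) (extend_integrator k b r R)"
proof -
  let ?E = "extend_integrator k b r R"
  have mono: "R x \<le> R y" if "0 \<le> x" "x \<le> y" "y < b" for x y
    using R that by (auto simp: integrator_def half_open_def intro: mono_onD)
  have R0: "R 0 = 0" using R by (simp add: integrator_def)
  have le: "R x \<le> r" if "0 \<le> x" "x < b" for x
    using integrator_end_value(2)[OF R \<open>0 < b\<close> that] r by simp
  have nonneg: "0 \<le> R x" if "0 \<le> x" "x < b" for x
    using mono[of 0 x] that R0 by simp
  have r0: "0 \<le> r" using le[of 0] \<open>0 < b\<close> R0 by simp
  show "mono ?E"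
  proof (rule monoI)
    fix x y :: real assume "x \<le> y"
    then have "0 \<le> k * (y - b)" if "b \<le> y" using that \<open>0 \<le> k\<close> by simp
    moreover have "k * (x - b) \<le> k * (y - b)" using \<open>x \<le> y\<close> \<open>0 \<le> k\<close> by (intro mult_left_mono) auto
    ultimately show "?E x \<le> ?E y"
      using mono[of x y] nonneg[of y] le[of x] r0 \<open>x \<le> y\<close> \<open>0 < b\<close>
      by (auto simp: extend_integrator_def)
  qed
  have "(?E \<longlongrightarrow> ?E x) (at_left x)"
  proof -
    consider "x \<le> 0" | "0 < x" "x < b" | "x = b" | "b < x" by linarith
    then show ?thesis
    proof cases
      case 1
      then have "\<forall>\<^sub>F t in at_left x. ?E t = ?E x"
        unfolding eventually_at_left[of "x - 1" x, simplified] using R0 \<open>0 < b\<close>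
        by (intro exI[of _ "x - 1"]) (auto simp: extend_integrator_def)
      then show ?thesis by (rule tendsto_eventually)
    next
      case 2
      then have "(R \<longlongrightarrow> R x) (at_left x)"
        using R by (auto simp: integrator_def half_open_def continuous_within)
      moreover have "\<forall>\<^sub>F t in at_left x. R t = ?E t"
        unfolding eventually_at_left[OF \<open>0 < x\<close>] using 2
        by (intro exI[of _ 0]) (auto simp: extend_integrator_def)
      ultimately show ?thesis
        using 2 by (auto simp: extend_integrator_def elim: Lim_transform_eventually)
    next
      case 3
      have "(R \<longlongrightarrow> r) (at_left b)"
        using integrator_end_value(1)[OF R \<open>0 < b\<close>] r by simp
      moreover have "\<forall>\<^sub>F t in at_left b. R t = ?E t"
        unfolding eventually_at_left[OF \<open>0 < b\<close>] using \<open>0 < b\<close>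
        by (intro exI[of _ 0]) (auto simp: extend_integrator_def)
      ultimately have "(?E \<longlongrightarrow> r) (at_left b)" by (rule Lim_transform_eventually)
      with 3 \<open>0 < b\<close> show ?thesis by (simp add: extend_integrator_def)
    next
      case 4
      have "((\<lambda>t. r + k * (t - b)) \<longlongrightarrow> r + k * (x - b)) (at_left x)"
        by (intro tendsto_intros)
      moreover have "\<forall>\<^sub>F t in at_left x. r + k * (t - b) = ?E t"
        unfolding eventually_at_left[OF \<open>b < x\<close>] using 4 \<open>0 < b\<close>
        by (intro exI[of _ b]) (auto simp: extend_integrator_def)
      ultimately have "(?E \<longlongrightarrow> r + k * (x - b)) (at_left x)" by (rule Lim_transform_eventually)
      with 4 \<open>0 < b\<close> show ?thesis by (simp add: extend_integrator_def)
    qed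
  qed
  then show "continuous (at_left x) ?E" by (simp add: continuous_within)
qed

lemma left_measure_singleton:
  assumes "mono F" "\<And>x. continuous (at_left x) F" and right: "(F \<longlongrightarrow> F x) (at_right x)"
  shows "emeasure (left_measure F) {x} = 0"
proof -
  have "((\<lambda>y. ennreal (F y - F x)) \<longlongrightarrow> ennreal (F x - F x)) (at_right x)"
    using right by (intro tendsto_ennrealI tendsto_intros)
  moreover have "\<forall>\<^sub>F y in at_right x. emeasure (left_measure F) {x} \<le> ennreal (F y - F x)"
    unfolding eventually_at_right[of x "x + 1", simplified]
  proof (intro exI[of _ "x + 1"] conjI allI impI)
    fix y assume y: "x < y"
    have "emeasure (left_measure F) {x} \<le> emeasure (left_measure F) {x..<y}"
      using y by (intro emeasure_mono) auto
    also have "\<dots> = ennreal (F y - F x)"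
      using y by (intro emeasure_left_measure assms) auto
    finally show "emeasure (left_measure F) {x} \<le> ennreal (F y - F x)" .
  qed simp
  ultimately have "emeasure (left_measure F) {x} \<le> ennreal (F x - F x)"
    by (intro tendsto_lowerbound) auto
  then show ?thesis by simp
qed

section \<open>Solutions of the given systems\<close>

text \<open>
  For \<open>x\<close> in \<open>[0,B)\<close> the interval \<open>[0,x)\<close> lies in \<open>[0,B)\<close>, so its integrals are the same for a
  measure and for its restriction.
\<close>

lemma solution_restrict_space:
  assumes \<mu>: "LS_measure B R1 = restrict_space \<mu> (half_open B)" "sets \<mu> = sets borel"
    and \<nu>: "LS_measure B R2 = restrict_space \<nu> (half_open B)" "sets \<nu> = sets borel"
    and "measure_pair \<mu> \<nu>"
  shows "solution B R1 R2 z u \<longleftrightarrow> u \<in> extensional (half_open B) \<and> measure_pair.solves \<mu> \<nu> (half_open B) z u"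
proof -
  have *: "set_integrable (restrict_space \<sigma> (half_open B)) {0..<x} f = set_integrable \<sigma> {0..<x} f"
    "(LINT t:{0..<x}|restrict_space \<sigma> (half_open B). f t) = (LINT t:{0..<x}|\<sigma>. f t)"
    if "sets \<sigma> = sets borel" "x \<in> half_open B" for \<sigma> x and f :: "real \<Rightarrow> complex"
  proof -
    have "{0..<x} \<subseteq> half_open B"
      using that(2) by (auto simp: half_open_def intro: ereal_less_mono[OF less_imp_le])
    then have eq: "indicator (half_open B) t *\<^sub>R indicator {0..<x} t *\<^sub>R f t = indicator {0..<x} t *\<^sub>R f t" for t
      by (auto simp: indicator_def)
    have H: "half_open B \<inter> space \<sigma> \<in> sets \<sigma>"
      using that(1) by (intro sets.Int) auto
    show "set_integrable (restrict_space \<sigma> (half_open B)) {0..<x} f = set_integrable \<sigma> {0..<x} f"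
      unfolding set_integrable_def integrable_restrict_space[OF H] eq ..
    show "(LINT t:{0..<x}|restrict_space \<sigma> (half_open B). f t) = (LINT t:{0..<x}|\<sigma>. f t)"
      unfolding set_lebesgue_integral_def integral_restrict_space[OF H] eq ..
  qed
  have "(set_integrable (LS_measure B R1) {0..<x} (\<lambda>t. snd (u t)) \<and>
        set_integrable (LS_measure B R2) {0..<x} (\<lambda>t. fst (u t)) \<and>
        fst (u x) = fst (u 0) + (LINT t:{0..<x}|LS_measure B R1. snd (u t)) \<and>
        snd (u x) = snd (u 0) - z * (LINT t:{0..<x}|LS_measure B R2. fst (u t))) =
      (set_integrable \<mu> {0..<x} (\<lambda>t. snd (u t)) \<and>
        set_integrable \<nu> {0..<x} (\<lambda>t. fst (u t)) \<and>
        fst (u x) = fst (u 0) + (LINT t:{0..<x}|\<mu>. snd (u t)) \<and>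
        snd (u x) = snd (u 0) - z * (LINT t:{0..<x}|\<nu>. fst (u t)))" if "x \<in> half_open B" for x
    unfolding \<mu>(1) \<nu>(1) *[OF \<mu>(2) that] *[OF \<nu>(2) that] by (rule refl)
  then show ?thesis
    unfolding solution_def measure_pair.solves_def[OF assms(5)] by (intro conj_cong[OF refl] ball_cong[OF refl])
qed

lemma the_solution:
  assumes \<mu>: "LS_measure B R1 = restrict_space \<mu> (half_open B)" "sets \<mu> = sets borel"
    and \<nu>: "LS_measure B R2 = restrict_space \<nu> (half_open B)" "sets \<nu> = sets borel"
    and mp: "measure_pair \<mu> \<nu>" and u: "measure_pair.solves \<mu> \<nu> UNIV z u" and "u 0 = w" and "0 < B"
    and x: "x \<in> half_open B"
  shows "(THE v. solution B R1 R2 z v \<and> v 0 = w) x = u x"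
proof -
  interpret measure_pair \<mu> \<nu> by fact
  let ?H = "half_open B"
  note sol = solution_restrict_space[OF \<mu> \<nu> mp]
  have 0: "0 \<in> ?H" using \<open>0 < B\<close> by (simp add: half_open_def zero_ereal_def)
  have H: "0 \<le> x \<and> {0..x} \<subseteq> ?H" if "x \<in> ?H" for x
    using that by (auto simp: half_open_def intro: ereal_less_mono)
  have "solves ?H z u" using u unfolding solves_def by blast
  then have "solves ?H z (restrict u ?H)"
    using solves_cong[of ?H u "restrict u ?H"] H by simp
  then have ex: "solution B R1 R2 z (restrict u ?H) \<and> restrict u ?H 0 = w"
    using sol 0 \<open>u 0 = w\<close> by simp
  have "v = restrict u ?H" if v: "solution B R1 R2 z v \<and> v 0 = w" for v
  proof (rule extensionalityI[where A = ?H])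
    show "v y = restrict u ?H y" if "y \<in> ?H" for y
    proof (rule unique_solution[where X = ?H])
      show "solves ?H z v" "solves ?H z (restrict u ?H)" using v ex sol by auto
      show "v 0 = restrict u ?H 0" using v ex by simp
      show "y \<in> ?H" "0 \<le> y" using that H by auto
      show "s \<in> ?H" if "t \<in> ?H" "0 \<le> s" "s \<le> t" for s t
        using H[OF that(1)] that by auto
    qed
  qed (use v sol in auto)
  then have "(THE v. solution B R1 R2 z v \<and> v 0 = w) = restrict u ?H"
    using ex by (intro the_equality) auto
  then show ?thesis using x by simp
qed

section \<open>Equality of the Titchmarsh-Weyl coefficients\<close>

theorem proposition4p8:
  fixes b :: real and R1 R2 :: "real \<Rightarrow> real"
  assumes "integral_system (ereal b) R1 R2"
    and "regular_system (ereal b) R1 R2"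
  shows "\<forall>z. z \<notin> \<real> \<longrightarrow>
    has_principal_TW \<infinity> (continuation1 b R1) (continuation2 b R2) z \<and>
    has_principal_TW (ereal b) R1 R2 z \<and>
    principal_TW \<infinity> (continuation1 b R1) (continuation2 b R2) z = principal_TW (ereal b) R1 R2 z"
proof (intro allI impI)
  fix z :: complex assume z: "z \<notin> \<real>"
  have b: "0 < b" and R: "integrator (ereal b) R1" "integrator (ereal b) R2"
    and disc: "no_common_discontinuity (ereal b) R1 R2"
    using assms(1) by (auto simp: integral_system_def)
  obtain r1 r2 where r: "end_value (ereal b) R1 = ereal r1" "end_value (ereal b) R2 = ereal r2"
    using regular_end_value[OF R b assms(2)] .
  define E1 E2 where "E1 = extend_integrator 0 b r1 R1" and "E2 = extend_integrator 1 b r2 R2"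
  define \<mu> \<nu> where "\<mu> = left_measure E1" and "\<nu> = left_measure E2"
  have E1: "mono E1" "\<And>x. continuous (at_left x) E1" and E2: "mono E2" "\<And>x. continuous (at_left x) E2"
    using extend_integrator_regular[OF R(1) b r(1), of 0] extend_integrator_regular[OF R(2) b r(2), of 1]
    by (simp_all add: E1_def E2_def)
  have sets: "sets \<mu> = sets borel" "sets \<nu> = sets borel"
    by (simp_all add: \<mu>_def \<nu>_def)
  have mp: "measure_pair \<mu> \<nu>"
  proof (rule measure_pair.intro)
    show "sigma_finite_measure \<mu>" "sigma_finite_measure \<nu>"
      unfolding \<mu>_def \<nu>_def by (intro sigma_finite_left_measure E1 E2)+
    show "emeasure \<mu> {0..<x} < \<infinity>" "emeasure \<nu> {0..<x} < \<infinity>" for x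
      unfolding \<mu>_def \<nu>_def
      using emeasure_left_measure[OF E1, of 0 x] emeasure_left_measure[OF E2, of 0 x]
      by (cases "0 \<le> x"; simp)+
  qed (rule sets)+
  then interpret measure_pair \<mu> \<nu> .
  have LSb: "LS_measure (ereal b) R1 = restrict_space \<mu> (half_open (ereal b))"
    "LS_measure (ereal b) R2 = restrict_space \<nu> (half_open (ereal b))"
    unfolding \<mu>_def \<nu>_def
    by (rule LS_measure_eq; use E1 E2 in \<open>simp add: E1_def E2_def extend_integrator_def half_open_def\<close>)+
  have LSinf: "LS_measure \<infinity> (continuation1 b R1) = restrict_space \<mu> (half_open \<infinity>)"
    "LS_measure \<infinity> (continuation2 b R2) = restrict_space \<nu> (half_open \<infinity>)"
    unfolding \<mu>_def \<nu>_def
    by (rule LS_measure_eq; use E1 E2 r in \<open>simp add: E1_def E2_def extend_integrator_def half_open_def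
          continuation1_def continuation2_def\<close>)+
  \<comment> \<open>Outside \<open>[0,b)\<close> the extension of \<open>R\<^sub>1\<close> is locally constant to the right, so \<open>\<mu>\<close> has no atoms there.\<close>
  have no_atoms: "emeasure \<mu> {x} = 0 \<or> emeasure \<nu> {x} = 0" for x
  proof -
    have "(E1 \<longlongrightarrow> E1 x) (at_right x) \<or> (E2 \<longlongrightarrow> E2 x) (at_right x)"
    proof -
      consider "x < 0" | "0 \<le> x" "x < b" | "b \<le> x" by linarith
      then show ?thesis
      proof cases
        case 1
        then have "\<forall>\<^sub>F t in at_right x. E1 t = E1 x"
          unfolding eventually_at_right[OF 1] by (intro exI[of _ 0]) (auto simp: E1_def extend_integrator_def)
        then show ?thesis by (intro disjI1 tendsto_eventually)
      next
        case 2
        have right: "(extend_integrator k b r R \<longlongrightarrow> extend_integrator k b r R x) (at_right x)"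
          if "continuous (at x within half_open (ereal b)) R" for R k r
        proof -
          have sub: "{x..(x + b) / 2} \<subseteq> half_open (ereal b)"
            using 2 by (auto simp: half_open_def)
          have "(R \<longlongrightarrow> R x) (at_right x)"
            using tendsto_within_subset[OF that[unfolded continuous_within] sub] 2
            by (simp add: at_within_Icc_at_right)
          moreover have "\<forall>\<^sub>F t in at_right x. R t = extend_integrator k b r R t"
            unfolding eventually_at_right[OF \<open>x < b\<close>] using 2
            by (intro exI[of _ b]) (auto simp: extend_integrator_def)
          ultimately have "(extend_integrator k b r R \<longlongrightarrow> R x) (at_right x)"
            by (rule Lim_transform_eventually)
          then show ?thesis using 2 by (simp add: extend_integrator_def)
        qed
        then show ?thesis
          using disc 2 unfolding E1_def E2_def no_common_discontinuity_def by (auto simp: half_open_def)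
      next
        case 3
        then have "\<forall>\<^sub>F t in at_right x. E1 t = E1 x"
          unfolding eventually_at_right[of x "x + 1", simplified] using b
          by (intro exI[of _ "x + 1"]) (auto simp: E1_def extend_integrator_def)
        then show ?thesis by (intro disjI1 tendsto_eventually)
      qed
    qed
    then show ?thesis
      unfolding \<mu>_def \<nu>_def using left_measure_singleton[OF E1] left_measure_singleton[OF E2] by blast
  qed
  obtain c where c: "solves UNIV z c" "c 0 = (1, 0)" using exists_solution by blast
  obtain s where s: "solves UNIV z s" "s 0 = (0, 1)" using exists_solution by blast
  define q where "q = fst (s b) / fst (c b)"
  have TWb: "TW_quotient (ereal b) R1 R2 z x = fst (s x) / fst (c x)" if "0 \<le> x" "x < b" for x
  proof -
    have H: "0 < ereal b" "x \<in> half_open (ereal b)"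
      using that b by (simp_all add: half_open_def)
    note the = the_solution[OF LSb(1) sets(1) LSb(2) sets(2) mp _ _ H]
    show ?thesis
      unfolding TW_quotient_def c_solution_def s_solution_def the[OF c] the[OF s] ..
  qed
  have TWinf: "TW_quotient \<infinity> (continuation1 b R1) (continuation2 b R2) z x = fst (s x) / fst (c x)"
    if "0 \<le> x" for x
  proof -
    have H: "0 < (\<infinity> :: ereal)" "x \<in> half_open \<infinity>"
      using that by (simp_all add: half_open_def)
    note the = the_solution[OF LSinf(1) sets(1) LSinf(2) sets(2) mp _ _ H]
    show ?thesis
      unfolding TW_quotient_def c_solution_def s_solution_def the[OF c] the[OF s] ..
  qed
  have "fst (c b) \<noteq> 0"
  proof (rule solution_nonzero)
    show "solves {0..b} z c" using c(1) unfolding solves_def by blast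
  qed (use b c(2) z no_atoms in auto)
  then have "((\<lambda>x. fst (s x) / fst (c x)) \<longlongrightarrow> q) (at_left b)"
    unfolding q_def by (intro tendsto_divide solution_left_continuous[OF s(1) b] solution_left_continuous[OF c(1) b])
  moreover have "\<forall>\<^sub>F x in at_left b. fst (s x) / fst (c x) = TW_quotient (ereal b) R1 R2 z x"
    unfolding eventually_at_left[OF b] using b TWb by (intro exI[of _ 0]) auto
  ultimately have "(TW_quotient (ereal b) R1 R2 z \<longlongrightarrow> q) (at_left b)"
    by (rule Lim_transform_eventually)
  then have limb: "((\<lambda>x. TW_quotient (ereal b) R1 R2 z (real_of_ereal x)) \<longlongrightarrow> q) (at_left (ereal b))"
    by (simp add: at_left_ereal filterlim_filtermap)
  have const: "fst (u x) = fst (u b)" if "solves UNIV z u" "b \<le> x" for u x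
  proof (rule solution_eventually_const[OF that(1) _ that(2)])
    show "emeasure \<mu> {b..<x} = 0"
      unfolding \<mu>_def emeasure_left_measure[OF E1 that(2)] using that(2) b
      by (simp add: E1_def extend_integrator_def)
  qed (use b in simp)
  have beyond: "TW_quotient \<infinity> (continuation1 b R1) (continuation2 b R2) z x = q" if "b \<le> x" for x
  proof -
    have "0 \<le> x" using b that by simp
    then show ?thesis
      unfolding q_def const[OF s(1) that, symmetric] const[OF c(1) that, symmetric] by (rule TWinf)
  qed
  have "\<forall>\<^sub>F x in at_top. TW_quotient \<infinity> (continuation1 b R1) (continuation2 b R2) z x = q"
    by (rule eventually_mono[OF eventually_ge_at_top[of b] beyond])
  then have liminf: "((\<lambda>x. TW_quotient \<infinity> (continuation1 b R1) (continuation2 b R2) z (real_of_ereal x))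
      \<longlongrightarrow> q) (at_left \<infinity>)"
    by (simp add: at_left_PInf filterlim_filtermap tendsto_eventually)
  have "principal_TW (ereal b) R1 R2 z = q" "principal_TW \<infinity> (continuation1 b R1) (continuation2 b R2) z = q"
    unfolding principal_TW_def by (intro tendsto_Lim limb liminf; simp)+
  with limb liminf show "has_principal_TW \<infinity> (continuation1 b R1) (continuation2 b R2) z \<and>
      has_principal_TW (ereal b) R1 R2 z \<and>
      principal_TW \<infinity> (continuation1 b R1) (continuation2 b R2) z = principal_TW (ereal b) R1 R2 z"
    unfolding has_principal_TW_def by auto
qed

end
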